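(* Let $k \ge 1$, $r = (r_1,\ldots,r_k) \in \mathbb{Z}_{\ge 0}^k$ and $w = (w_1,\ldots,w_k) \in \mathbb{Z}_{\ge 1}^k$ satisfy $r_1/w_1 \le \cdots \le r_k/w_k$ and $0 \le r_1 < w_1$. Let $W = \max_i w_i$, $R = \max_i r_i$, $p = w_1 r_k - w_k r_1$, and $P_n = \langle w_1 n + r_1, \ldots, w_k n + r_k\rangle$. For any integer $n > w_1^2 W R^2$, the map $\varphi_n : \operatorname{Betti}(P_n) \to \operatorname{Betti}(P_{n+p})$ given by $$\beta \mapsto \begin{cases} \beta + \lambda p & \text{if } \mathsf{L}_{P_n,w}(\beta) = \{\lambda\},\\ \beta + \lambda p + d w_1\big(w_k (n+p) + r_k\big) & \text{if } \mathsf{L}_{P_n,w}(\beta) = \{\lambda, \lambda + d\},\end{cases}$$ is a bijection, where $\Delta_w(P_n) = \{d\}$ (if $\Delta_w(P_n)$ is empty, only the first case occurs).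
   Context: $\langle g_1,\ldots,g_k\rangle = \{\sum z_i g_i : z_i \in \mathbb{Z}_{\ge 0}\}$. For $m \in P_n$, $\mathsf{Z}_{P_n}(m) = \{z \in \mathbb{Z}_{\ge 0}^k : m = \sum_i z_i (w_i n + r_i)\}$ is the set of factorizations of $m$; the weighted length of $z$ is $|z|_w = w_1 z_1 + \cdots + w_k z_k$, and $\mathsf{L}_{P_n,w}(m) = \{|z|_w : z \in \mathsf{Z}_{P_n}(m)\}$. Writing $\mathsf{L}_{P_n,w}(m) = \{\ell_1 < \cdots < \ell_s\}$, put $\Delta_{P_n,w}(m) = \{\ell_i - \ell_{i-1} : 2 \le i \le s\}$, and $\Delta_w(P_n) = \bigcup_{m \in P_n}\Delta_{P_n,w}(m)$. The factorization graph $\nabla_m$ has vertex set $\mathsf{Z}_{P_n}(m)$, with $z,z'$ joined by an edge whenever $z_i>0$ and $z'_i>0$ for some $i$; $m$ is a Betti element if $\nabla_m$ is disconnected, and $\operatorname{Betti}(P_n)$ is the set of Betti elements of $P_n$. For $P_{n+p}$, the same definitions apply with $n$ replaced by $n+p$. The conditions on $r$ and $w$ in the claim are the paper's standing normalizations. *)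

theory Defs
  imports Complex_Main "HOL-Library.FuncSet"
begin

text \<open>
  Finite sequences indexed by \<open>1, \<dots>, k\<close> are functions on \<^typ>\<open>nat\<close> of which only the values on
  \<open>{1..k}\<close> are used. Factorizations are made extensional, so that they correspond exactly to
  \<open>k\<close>-tuples of natural numbers.
\<close>

definition monoid_gen :: "nat \<Rightarrow> (nat \<Rightarrow> nat) \<Rightarrow> nat set" where
  "monoid_gen k g = {\<Sum>i=1..k. z i * g i | z. z \<in> {1..k} \<rightarrow>\<^sub>E UNIV}"

definition factorizations :: "nat \<Rightarrow> (nat \<Rightarrow> nat) \<Rightarrow> nat \<Rightarrow> (nat \<Rightarrow> nat) set" where
  "factorizations k g m = {z \<in> {1..k} \<rightarrow>\<^sub>E UNIV. m = (\<Sum>i=1..k. z i * g i)}"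

definition wlength :: "nat \<Rightarrow> (nat \<Rightarrow> nat) \<Rightarrow> (nat \<Rightarrow> nat) \<Rightarrow> nat" where
  "wlength k w z = (\<Sum>i=1..k. w i * z i)"

definition wlength_set :: "nat \<Rightarrow> (nat \<Rightarrow> nat) \<Rightarrow> (nat \<Rightarrow> nat) \<Rightarrow> nat \<Rightarrow> nat set" where
  "wlength_set k w g m = wlength k w ` factorizations k g m"

definition gaps :: "nat set \<Rightarrow> nat set" where
  "gaps L = {b - a | a b. a \<in> L \<and> b \<in> L \<and> a < b \<and> {a<..<b} \<inter> L = {}}"

definition delta_set :: "nat \<Rightarrow> (nat \<Rightarrow> nat) \<Rightarrow> (nat \<Rightarrow> nat) \<Rightarrow> nat set" where
  "delta_set k w g = (\<Union>m \<in> monoid_gen k g. gaps (wlength_set k w g m))"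

definition factorization_edges ::
    "nat \<Rightarrow> (nat \<Rightarrow> nat) \<Rightarrow> nat \<Rightarrow> ((nat \<Rightarrow> nat) \<times> (nat \<Rightarrow> nat)) set" where
  "factorization_edges k g m =
     {(z, z'). z \<in> factorizations k g m \<and> z' \<in> factorizations k g m \<and>
               (\<exists>i\<in>{1..k}. z i > 0 \<and> z' i > 0)}"

definition betti :: "nat \<Rightarrow> (nat \<Rightarrow> nat) \<Rightarrow> nat set" where
  "betti k g = {m \<in> monoid_gen k g.
     \<exists>z \<in> factorizations k g m. \<exists>z' \<in> factorizations k g m.
       (z, z') \<notin> (factorization_edges k g m)\<^sup>*}"

definition shifted_gens :: "(nat \<Rightarrow> nat) \<Rightarrow> (nat \<Rightarrow> nat) \<Rightarrow> nat \<Rightarrow> nat \<Rightarrow> nat" where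
  "shifted_gens w r n i = w i * n + r i"

text \<open>
  The subtraction is on \<^typ>\<open>nat\<close>; it does not truncate under the ordering assumption on the
  ratios \<open>r i / w i\<close>, see lemma \<open>int_period\<close>.
\<close>

definition period :: "nat \<Rightarrow> (nat \<Rightarrow> nat) \<Rightarrow> (nat \<Rightarrow> nat) \<Rightarrow> nat" where
  "period k w r = w 1 * r k - w k * r 1"

lemma int_period:
  assumes "k \<ge> 1" and "\<And>i. i \<in> {1..k} \<Longrightarrow> w i \<ge> 1"
    and "mono_on {1..k} (\<lambda>i. real (r i) / real (w i))"
  shows "int (period k w r) = int (w 1) * int (r k) - int (w k) * int (r 1)"
proof -
  have "real (r 1) / real (w 1) \<le> real (r k) / real (w k)"
    using assms(1) by (intro mono_onD[OF assms(3)]) auto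
  moreover have "real (w 1) > 0" "real (w k) > 0"
    using assms(1) assms(2)[of 1] assms(2)[of k] by auto
  ultimately have "real (w k * r 1) \<le> real (w 1 * r k)"
    by (simp only: of_nat_mult) (simp add: divide_le_eq pos_le_divide_eq mult.commute field_simps)
  then have "w k * r 1 \<le> w 1 * r k"
    by linarith
  then show ?thesis
    unfolding period_def by (simp add: of_nat_diff)
qed

text \<open>
  The two branches are characterized by the lemmas \<open>betti_map_single\<close> and \<open>betti_map_pair\<close>. The
  value is meaningless when the length set has neither of the two forms, which the main statement
  excludes on the Betti elements.
\<close>

definition betti_map :: "nat \<Rightarrow> (nat \<Rightarrow> nat) \<Rightarrow> (nat \<Rightarrow> nat) \<Rightarrow> nat \<Rightarrow> nat \<Rightarrow> nat" where
  "betti_map k w r n \<beta> =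
     (let g = shifted_gens w r n; p = period k w r; L = wlength_set k w g \<beta> in
      if \<exists>l. L = {l} then \<beta> + (THE l. L = {l}) * p
      else let d = (THE d. delta_set k w g = {d}) in
        \<beta> + (THE l. L = {l, l + d}) * p + d * w 1 * (w k * (n + p) + r k))"

lemma betti_map_single:
  assumes "wlength_set k w (shifted_gens w r n) \<beta> = {l}"
  shows "betti_map k w r n \<beta> = \<beta> + l * period k w r"
  using assms by (simp add: betti_map_def)

lemma betti_map_pair:
  assumes "delta_set k w (shifted_gens w r n) = {d}"
    and "wlength_set k w (shifted_gens w r n) \<beta> = {l, l + d}"
  shows "betti_map k w r n \<beta> =
    \<beta> + l * period k w r + d * w 1 * (w k * (n + period k w r) + r k)"
proof -
  have "d \<in> delta_set k w (shifted_gens w r n)"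
    using assms(1) by simp
  then have "d > 0"
    by (auto simp: delta_set_def gaps_def)
  then have "\<nexists>\<mu>. {l, l + d} = {\<mu>}"
    by auto
  moreover have "(THE \<mu>. {l, l + d} = {\<mu>, \<mu> + d}) = l"
    using \<open>d > 0\<close> by (intro the_equality) (auto simp: doubleton_eq_iff)
  ultimately show ?thesis
    using assms by (simp add: betti_map_def Let_def)
qed

end

theory Submission
  imports Defs
begin

text \<open>
  Write \<open>v i = (w i, r i)\<close>. A factorization \<open>z\<close> of \<open>m\<close> in \<open>P\<^sub>n\<close> has a bidegree, the lattice point
  \<open>(x, y) = (\<Sum>i. z i * w i, \<Sum>i. z i * r i)\<close>; its first coordinate is the weighted length, and
  \<open>m = x * n + y\<close>. Hence the factorizations of \<open>m\<close> are grouped by the points of the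
  two-dimensional monoid \<open>H\<close> generated by the \<open>v i\<close> that lie on the line \<open>x * n + y = m\<close>. The
  monoid \<open>H\<close>, and the factorization graph of a single point of it, do not involve \<open>n\<close>; only the
  way in which lines cut \<open>H\<close> does. By the ordering of the slopes, \<open>H\<close> lies in the cone spanned by
  \<open>v 1\<close> and \<open>v k\<close>, and the determinants of a point against \<open>v 1\<close> and against \<open>v k\<close> measure its
  distance to the two boundary rays.

  If a line contains two points of \<open>H\<close>, then for large \<open>n\<close> the one of smaller length is far from
  the ray of \<open>v 1\<close> and the one of larger length is far from the ray of \<open>v k\<close>
  (\<open>shorter_deep\<close>). A factorization of a point far from the ray of \<open>v 1\<close> has so many parts off
  that ray that, by the pigeonhole principle in the finite quotient of the plane lattice by
  \<open>v 1\<close> and \<open>v k\<close>, some of them can be traded for copies of \<open>v 1\<close> and \<open>v k\<close>, at least one \<open>v k\<close>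
  among them; symmetrically at the other ray (\<open>exchange\<close>, \<open>move_to_last\<close>, \<open>move_to_first\<close>). This
  has two consequences. First, all factorizations other than those of maximal length are linked
  through the generator \<open>k\<close>, and all other than those of minimal length through the generator \<open>1\<close>
  (\<open>linked_shorter\<close>, \<open>linked_longer\<close>). Second, every point of the group generated by \<open>H\<close> that is
  far from both rays lies in \<open>H\<close> (\<open>in_monoid_of_deep_in_group\<close>), so that consecutive lengths on a
  line always differ by the least \<open>d > 0\<close> with \<open>(d, - d * n)\<close> in that group. Because
  \<open>(0, p) = w 1 * v k - w k * v 1\<close> is in the group, \<open>d\<close> is the same for \<open>n\<close> and \<open>n + p\<close>.

  Therefore the Betti elements fall into two classes. Those with one length are the values
  \<open>x * n + y\<close> at the points \<open>(x, y)\<close> whose own factorization graph is disconnected, a set of points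
  independent of \<open>n\<close> (\<open>betti_single\<close>). Those with two lengths come from pairs of neighbouring
  points \<open>(x, y)\<close> and \<open>(x + d, y - d * n)\<close> of \<open>H\<close> from which no common generator can be removed
  (\<open>betti_pair\<close>; \<open>betti_cases\<close> says that there are no others). Passing from \<open>n\<close> to \<open>n + p\<close> fixes
  the points of the first kind and moves a pair by \<open>d * w 1\<close> copies of \<open>v k\<close> at its shorter point
  and \<open>d * w k\<close> copies of \<open>v 1\<close> at its longer point. Both displacements agree with the difference
  vector changing from \<open>(d, - d * n)\<close> to \<open>(d, - d * (n + p))\<close>, and they neither create nor destroy
  membership in \<open>H\<close>, since the points are far from the opposite rays (\<open>shift_pair_iff\<close>). The values
  of the moved points are those of the map in the theorem. If \<open>p = 0\<close>, all the \<open>v i\<close> lie on one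
  ray, every element has one length, and the map is the identity.
\<close>

(* Facts about the index 1 would no longer match if simplification turned it into a successor. *)
declare One_nat_def [simp del]

section \<open>Chains of sub-factorizations\<close>

text \<open>
  The partial sums needed for the pigeonhole argument: a vector of total \<open>N\<close> is built up from zero
  by adding one part at a time.
\<close>
lemma unit_step_chain:
  fixes z :: "'a \<Rightarrow> nat"
  assumes "finite A" "sum z A = N"
  shows "\<exists>c. (\<forall>j\<le>N. (\<forall>i\<in>A. c j i \<le> z i) \<and> sum (c j) A = j) \<and>
             (\<forall>j\<le>N. \<forall>j'\<le>j. \<forall>i\<in>A. c j' i \<le> c j i)"
  using assms(2)
proof (induction N arbitrary: z)
  case 0
  then show ?case by (intro exI[of _ "\<lambda>_ _. 0"]) auto
next
  case (Suc N)
  then obtain a where a: "a \<in> A" "0 < z a"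
    by (metis gr0I nat.distinct(1) sum.neutral)
  define y where "y = z(a := z a - 1)"
  have "sum z A = z a + sum z (A - {a})" "sum y A = y a + sum y (A - {a})"
    using assms(1) a(1) by (auto intro: sum.remove)
  moreover have "sum y (A - {a}) = sum z (A - {a})"
    by (intro sum.cong) (auto simp: y_def)
  ultimately have "sum y A = N" using Suc.prems a(2) by (simp add: y_def)
  from Suc.IH[OF this] obtain c where
    c_all: "\<forall>j\<le>N. (\<forall>i\<in>A. c j i \<le> y i) \<and> sum (c j) A = j"
           "\<forall>j\<le>N. \<forall>j'\<le>j. \<forall>i\<in>A. c j' i \<le> c j i"
    by (elim exE conjE)
  have c: "j \<le> N \<Longrightarrow> i \<in> A \<Longrightarrow> c j i \<le> y i" "j \<le> N \<Longrightarrow> sum (c j) A = j"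
       "j \<le> N \<Longrightarrow> j' \<le> j \<Longrightarrow> i \<in> A \<Longrightarrow> c j' i \<le> c j i" for i j j'
    using c_all by simp_all
  have yz: "y i \<le> z i" for i by (simp add: y_def)
  have cz: "c j i \<le> z i" if "j \<le> N" "i \<in> A" for j i
    using c(1)[OF that] yz[of i] by linarith
  define c' where "c' = c(Suc N := z)"
  have c': "c' (Suc N) = z" "j \<le> N \<Longrightarrow> c' j = c j" for j by (auto simp: c'_def)
  have "(\<forall>i\<in>A. c' j i \<le> z i) \<and> sum (c' j) A = j" if "j \<le> Suc N" for j
    using that c' cz c(2) Suc.prems by (cases "j = Suc N") auto
  moreover have "c' j' i \<le> c' j i" if "j \<le> Suc N" "j' \<le> j" "i \<in> A" for j j' i
  proof (cases "j' = Suc N \<or> j = Suc N")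
    case True
    then show ?thesis using that c' cz by (cases "j' = Suc N") auto
  next
    case False
    then show ?thesis using that c' c(3) by auto
  qed
  ultimately show ?case by (intro exI[of _ c']) blast
qed

section \<open>Bidegrees and the two boundary rays\<close>

locale shifted_family =
  fixes k :: nat and w r :: "nat \<Rightarrow> nat"
  assumes k_ge_1: "k \<ge> 1"
    and w_ge_1: "\<And>i. i \<in> {1..k} \<Longrightarrow> w i \<ge> 1"
    and mono_slopes: "mono_on {1..k} (\<lambda>i. real (r i) / real (w i))"
begin

abbreviation p :: int where "p \<equiv> int (period k w r)"

text \<open>
  Up to sign, the determinants of \<open>(x, y)\<close> with \<open>(w 1, r 1)\<close> and with \<open>(w k, r k)\<close>: both are
  nonnegative on the cone of the generators, and each vanishes on one of its boundary rays.
\<close>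
definition det1 :: "int \<Rightarrow> int \<Rightarrow> int" where
  "det1 x y = int (w 1) * y - int (r 1) * x"

definition detk :: "int \<Rightarrow> int \<Rightarrow> int" where
  "detk x y = int (r k) * x - int (w k) * y"

definition comb :: "(nat \<Rightarrow> int) \<Rightarrow> (nat \<Rightarrow> nat) \<Rightarrow> int" where
  "comb f z = (\<Sum>i=1..k. f i * int (z i))"

text \<open>
  The two coordinates of the bidegree of a factorization: the weighted length, and what remains of
  the value once \<open>n\<close> times the length is taken away.
\<close>
abbreviation ell :: "(nat \<Rightarrow> nat) \<Rightarrow> int" where "ell \<equiv> comb (\<lambda>i. int (w i))"
abbreviation rho :: "(nat \<Rightarrow> nat) \<Rightarrow> int" where "rho \<equiv> comb (\<lambda>i. int (r i))"

abbreviation s :: "nat \<Rightarrow> int" where "s i \<equiv> det1 (int (w i)) (int (r i))"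
abbreviation t :: "nat \<Rightarrow> int" where "t i \<equiv> detk (int (w i)) (int (r i))"

definition R where "R = Max (r ` {1..k})"
definition W where "W = Max (w ` {1..k})"
text \<open>
  \<open>S\<close> and \<open>T\<close> bound the distances of a single generator to the rays, \<open>q\<close> is the number of residue
  classes in the pigeonhole argument. The hypothesis on \<open>n\<close> is what makes \<open>q * S\<close> and \<open>q * T\<close>
  smaller than the first and the last generator of \<open>P\<^sub>n\<close>.
\<close>
definition S :: int where "S = int (w 1) * int R"
definition T :: int where "T = int W * int R"
definition q :: nat where "q = w 1 * period k w r"

lemma one_in: "1 \<in> {1..k}" and k_in: "k \<in> {1..k}"
  using k_ge_1 by auto

lemma w1_pos: "w 1 > 0" and wk_pos: "w k > 0"
  using w_ge_1[OF one_in] w_ge_1[OF k_in] by auto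

lemma slope_le:
  assumes "i \<in> {1..k}" "j \<in> {1..k}" "i \<le> j"
  shows "int (w j) * int (r i) \<le> int (w i) * int (r j)"
proof -
  have "real (r i) / real (w i) \<le> real (r j) / real (w j)"
    using assms by (intro mono_onD[OF mono_slopes]) auto
  moreover have "real (w i) > 0" "real (w j) > 0"
    using w_ge_1[OF assms(1)] w_ge_1[OF assms(2)] by auto
  ultimately have "real (w j * r i) \<le> real (w i * r j)"
    by (simp only: of_nat_mult) (simp add: divide_le_eq pos_le_divide_eq mult.commute field_simps)
  then have "w j * r i \<le> w i * r j" by linarith
  then show ?thesis by (metis of_nat_mult of_nat_mono)
qed

lemma p_eq: "p = int (w 1) * int (r k) - int (w k) * int (r 1)"
  using int_period[OF k_ge_1 w_ge_1 mono_slopes] by simp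

lemma s_nonneg: "i \<in> {1..k} \<Longrightarrow> 0 \<le> s i"
  using slope_le[OF one_in, of i] by (simp add: det1_def mult.commute)

lemma t_nonneg: "i \<in> {1..k} \<Longrightarrow> 0 \<le> t i"
  using slope_le[OF _ k_in, of i] by (simp add: detk_def mult.commute)

lemma r_le_R: "i \<in> {1..k} \<Longrightarrow> r i \<le> R" and w_le_W: "i \<in> {1..k} \<Longrightarrow> w i \<le> W"
  by (auto simp: R_def W_def)

lemma s_le: "i \<in> {1..k} \<Longrightarrow> s i \<le> S"
proof -
  assume "i \<in> {1..k}"
  then have "int (w 1) * int (r i) \<le> int (w 1) * int R"
    using r_le_R by (intro mult_left_mono) auto
  moreover have "0 \<le> int (r 1) * int (w i)" by simp
  ultimately show ?thesis unfolding det1_def S_def by linarith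
qed

lemma t_le: "i \<in> {1..k} \<Longrightarrow> t i \<le> T"
proof -
  assume i: "i \<in> {1..k}"
  have "int (w i) * int (r k) \<le> int W * int R"
    using r_le_R[OF k_in] w_le_W[OF i] by (intro mult_mono) auto
  then have "int (r k) * int (w i) \<le> int W * int R" by (simp only: mult.commute)
  moreover have "0 \<le> int (w k) * int (r i)" by simp
  ultimately show ?thesis unfolding detk_def T_def by linarith
qed

lemma s_k: "s k = p" and t_1: "t 1 = p"
  by (simp_all add: det1_def detk_def p_eq algebra_simps)

lemma cramer:
  "p * x = detk x y * int (w 1) + det1 x y * int (w k)"
  "p * y = detk x y * int (r 1) + det1 x y * int (r k)"
  by (simp_all add: p_eq det1_def detk_def algebra_simps)

lemma det_minus:
  "det1 (x - x') (y - y') = det1 x y - det1 x' y'"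
  "detk (x - x') (y - y') = detk x y - detk x' y'"
  by (simp_all add: det1_def detk_def algebra_simps)

lemma comb_cong: "(\<And>i. i \<in> {1..k} \<Longrightarrow> z i = z' i) \<Longrightarrow> comb f z = comb f z'"
  unfolding comb_def by (rule sum.cong) auto

lemma comb_restrict: "comb f (restrict z {1..k}) = comb f z"
  by (rule comb_cong) simp

lemma comb_add: "comb f (\<lambda>i. x i + y i) = comb f x + comb f y"
  by (simp add: comb_def sum.distrib algebra_simps)

lemma comb_diff:
  assumes "\<And>i. i \<in> {1..k} \<Longrightarrow> x i \<le> z i"
  shows "comb f (\<lambda>i. z i - x i) = comb f z - comb f x"
proof -
  have "comb f (\<lambda>i. z i - x i) + comb f x = comb f z"
    unfolding comb_add[symmetric] by (rule comb_cong) (use assms in auto)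
  then show ?thesis by simp
qed

lemma comb_unit: "j \<in> {1..k} \<Longrightarrow> comb f (\<lambda>i. if i = j then a else 0) = f j * int a"
  by (simp add: comb_def if_distrib[of int] if_distrib[of "\<lambda>x. _ * x"] cong: if_cong)

lemma comb_s: "comb s z = det1 (ell z) (rho z)" and comb_t: "comb t z = detk (ell z) (rho z)"
  by (simp_all add: comb_def det1_def detk_def sum_distrib_left sum_subtractf algebra_simps)

lemma comb_nonneg: "(\<And>i. i \<in> {1..k} \<Longrightarrow> 0 \<le> f i) \<Longrightarrow> 0 \<le> comb f z"
  by (auto simp: comb_def intro!: sum_nonneg)

lemma comb_ge:
  assumes "\<And>i. i \<in> {1..k} \<Longrightarrow> 0 \<le> f i" "j \<in> {1..k}" "0 < z j"
  shows "f j \<le> comb f z"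
proof -
  have "f j * 1 \<le> f j * int (z j)" using assms by (intro mult_left_mono) auto
  also have "\<dots> \<le> comb f z"
    unfolding comb_def using assms by (intro member_le_sum) auto
  finally show ?thesis by simp
qed

section \<open>Trading generators by the pigeonhole principle\<close>

text \<open>
  Two vectors with the same value here have bidegrees that differ by an integral combination of
  \<open>v 1\<close> and \<open>v k\<close>: the first component makes the distance to the ray of \<open>v 1\<close> a multiple \<open>b * p\<close>;
  after \<open>b * v k\<close> is subtracted the difference is parallel to \<open>v 1\<close>, and the second component makes
  its length divisible by \<open>w 1\<close>. This takes \<open>w 1 * p\<close> values although the quotient has only \<open>p\<close>
  elements; the bound on \<open>n\<close> has room for the factor \<open>w 1\<close>.
\<close>
definition lattice_class :: "(nat \<Rightarrow> nat) \<Rightarrow> int \<times> int" where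
  "lattice_class z = (comb s z mod p, (ell z - (comb s z div p) * int (w k)) mod int (w 1))"

text \<open>
  Add \<open>q\<close> parts from \<open>A\<close> one after the other: two of the \<open>q + 1\<close> partial sums have the same
  class, so that the parts between them add up to \<open>a * v 1 + b * v k\<close>. The coefficients are
  nonnegative because the sum lies in the cone, so \<open>a\<close> copies of \<open>v 1\<close> and \<open>b\<close> copies of \<open>v k\<close> can
  be substituted for these parts. If \<open>z\<close> has more than \<open>q\<close> parts in \<open>A\<close>, one of them stays behind
  and makes the new factorization adjacent to the old one. The last conjunct bounds \<open>a\<close> and \<open>b\<close>
  from below through the distances of one traded generator to the rays.
\<close>
lemma exchange:
  assumes p_pos: "0 < p" and A: "A \<subseteq> {1..k}" and many: "q \<le> sum z A"
  shows "\<exists>z' a b. z' \<in> {1..k} \<rightarrow>\<^sub>E UNIV \<and> ell z' = ell z \<and> rho z' = rho z \<and>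
           (q < sum z A \<longrightarrow> (\<exists>i\<in>{1..k}. 0 < z i \<and> 0 < z' i)) \<and> a \<le> int (z' 1) \<and> b \<le> int (z' k) \<and>
           (\<exists>i\<in>A. s i \<le> b * p \<and> t i \<le> a * p)"
proof -
  have finA: "finite A" using A finite_subset by blast
  obtain c0 where c0: "\<forall>j\<le>sum z A. (\<forall>i\<in>A. c0 j i \<le> z i) \<and> sum (c0 j) A = j"
     "\<forall>j\<le>sum z A. \<forall>j'\<le>j. \<forall>i\<in>A. c0 j' i \<le> c0 j i"
    using unit_step_chain[OF finA refl, of z] by (elim exE conjE)
  define c where "c j = (\<lambda>i. if i \<in> A then c0 j i else 0)" for j
  have c: "c j i \<le> z i" "sum (c j) A = j" "j' \<le> j \<Longrightarrow> c j' i \<le> c j i" if "j \<le> q" for i j j'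
    using c0 that many by (auto simp: c_def)
  have range: "(\<lambda>j. lattice_class (c j)) ` {0..q} \<subseteq> {0..<p} \<times> {0..<int (w 1)}"
    using p_pos w1_pos by (auto simp: lattice_class_def)
  have "card ({0..<p} \<times> {0..<int (w 1)}) = q"
    by (simp add: q_def card_cartesian_product)
  then have "card ((\<lambda>j. lattice_class (c j)) ` {0..q}) \<le> q"
    using card_mono[OF _ range] by simp
  then have "\<not> inj_on (\<lambda>j. lattice_class (c j)) {0..q}"
    by (intro pigeonhole) auto
  then obtain i0 j0 where "i0 \<le> q" "j0 \<le> q" "i0 \<noteq> j0" "lattice_class (c i0) = lattice_class (c j0)"
    by (auto simp: inj_on_def)
  then obtain i j where ij: "i < j" "j \<le> q" "lattice_class (c i) = lattice_class (c j)"
    by (metis linorder_neqE_nat)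
  \<comment> \<open>the parts that are traded\<close>
  define x where "x = (\<lambda>l. c j l - c i l)"
  have cij: "c i l \<le> c j l" for l using c(3)[of j i l] ij by simp
  have x_comb: "comb f x = comb f (c j) - comb f (c i)" for f
    unfolding x_def by (rule comb_diff) (rule cij)
  define b where "b = comb s (c j) div p - comb s (c i) div p"
  have sx: "comb s x = b * p"
  proof -
    have "comb s (c j) mod p = comb s (c i) mod p" using ij by (simp add: lattice_class_def)
    then show ?thesis unfolding x_comb b_def
      by (metis (no_types, lifting) add_diff_cancel_right left_diff_distrib div_mult_mod_eq)
  qed
  have "int (w 1) dvd (ell (c j) - comb s (c j) div p * int (w k)) -
                      (ell (c i) - comb s (c i) div p * int (w k))"
    using ij by (intro mod_eq_dvd_iff[THEN iffD1]) (simp add: lattice_class_def)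
  also have "\<dots> = ell x - b * int (w k)" by (simp add: x_comb b_def algebra_simps)
  finally obtain a where a: "ell x = a * int (w 1) + b * int (w k)"
    by (metis dvdE diff_add_cancel mult.commute)
  have "int (w 1) * rho x = b * p + int (r 1) * ell x"
    using sx unfolding comb_s unfolding det1_def by linarith
  also have "\<dots> = int (w 1) * (a * int (r 1) + b * int (r k))"
    by (simp add: a p_eq algebra_simps)
  finally have rx: "rho x = a * int (r 1) + b * int (r k)" using w1_pos by simp
  have tx: "comb t x = a * p"
    unfolding comb_t a rx by (simp add: detk_def p_eq algebra_simps)
  have "0 \<le> a * p" "0 \<le> b * p"
    using comb_nonneg[of s x] comb_nonneg[of t x] s_nonneg t_nonneg sx tx by auto
  then have ab: "0 \<le> a" "0 \<le> b" using p_pos by (auto simp: zero_le_mult_iff)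
  have xz: "x l \<le> z l" for l using c(1)[of j l] ij by (simp add: x_def le_diff_conv trans_le_add1)
  define z' where "z' = restrict (\<lambda>l. (z l - x l) + ((if l = 1 then nat a else 0) +
                                                   (if l = k then nat b else 0))) {1..k}"
  have comb_z': "comb f z' = comb f z - comb f x + (f 1 * a + f k * b)" for f
    unfolding z'_def comb_restrict comb_add
    using comb_diff[OF xz] comb_unit[OF one_in] comb_unit[OF k_in] ab by simp
  have "sum x A + sum (c i) A = sum (c j) A"
    unfolding sum.distrib[symmetric] by (rule sum.cong) (auto simp: x_def cij)
  then have sum_x: "sum x A = j - i" using c(2)[of i] c(2)[of j] ij by simp
  \<comment> \<open>one copy of \<open>i1\<close> at least is traded; one copy of \<open>i2\<close> below is kept, since at most \<open>q\<close> are traded\<close>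
  obtain i1 where i1: "i1 \<in> A" "0 < x i1"
    using sum_x ij by (metis gr0I sum.neutral zero_less_diff less_numeral_extra(3))
  have "\<exists>i\<in>{1..k}. 0 < z i \<and> 0 < z' i" if "q < sum z A"
  proof -
    have "\<not> sum z A \<le> sum x A" using sum_x ij that by linarith
    then obtain i2 where i2: "i2 \<in> A" "x i2 < z i2"
      by (meson not_less sum_mono)
    then show ?thesis using A by (intro bexI[of _ i2]) (auto simp: z'_def)
  qed
  moreover have "s i1 \<le> b * p" "t i1 \<le> a * p"
    unfolding sx[symmetric] tx[symmetric] using A i1 s_nonneg t_nonneg
    by (auto intro!: comb_ge)
  moreover have "a \<le> int (z' 1)" "b \<le> int (z' k)"
    using ab one_in k_in by (auto simp: z'_def)
  moreover have "ell z' = ell z" "rho z' = rho z"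
    unfolding comb_z' by (simp_all add: a rx algebra_simps)
  moreover have "z' \<in> {1..k} \<rightarrow>\<^sub>E UNIV" by (simp add: z'_def)
  ultimately show ?thesis using i1 by blast
qed

lemma many_of_large_comb:
  assumes f: "\<And>i. i \<in> {1..k} \<Longrightarrow> 0 \<le> f i" "\<And>i. i \<in> {1..k} \<Longrightarrow> f i \<le> B"
    and large: "N * B < comb f z"
  shows "N < int (sum z {i \<in> {1..k}. 0 < f i})"
proof (rule ccontr)
  assume *: "\<not> ?thesis"
  have B: "0 \<le> B" using f[OF one_in] by linarith
  have "comb f z = (\<Sum>i\<in>{i \<in> {1..k}. 0 < f i}. f i * int (z i))"
    unfolding comb_def using f(1) by (intro sum.mono_neutral_right) (force simp: not_less intro: antisym)+
  also have "\<dots> \<le> (\<Sum>i\<in>{i \<in> {1..k}. 0 < f i}. B * int (z i))"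
    using f(2) by (intro sum_mono mult_right_mono) auto
  also have "\<dots> = B * int (sum z {i \<in> {1..k}. 0 < f i})"
    by (simp add: sum_distrib_left)
  also have "\<dots> \<le> B * N" using * B by (intro mult_left_mono) linarith+
  finally show False using large by (simp add: mult.commute)
qed

text \<open>
  Trading only generators off the ray of \<open>v 1\<close> produces at least one copy of \<open>v k\<close>, because the
  traded parts have positive distance to that ray. Bare existence needs one part less than
  adjacency, and this sharper bound matters: after the removal of one further generator a point
  still satisfies it.
\<close>
lemma move_to_last:
  assumes p: "0 < p" and large: "(int q - 1) * S < comb s z"
  obtains z' where "z' \<in> {1..k} \<rightarrow>\<^sub>E UNIV" "ell z' = ell z" "rho z' = rho z" "0 < z' k"
    "int q * S < comb s z \<longrightarrow> (\<exists>i\<in>{1..k}. 0 < z i \<and> 0 < z' i)"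
proof -
  define A where "A = {i \<in> {1..k}. 0 < s i}"
  have "int q - 1 < int (sum z A)" unfolding A_def
    by (rule many_of_large_comb[of s, OF s_nonneg s_le large])
  then have "q \<le> sum z A" by linarith
  moreover have "A \<subseteq> {1..k}" by (auto simp: A_def)
  ultimately obtain z' a b i where
    z': "z' \<in> {1..k} \<rightarrow>\<^sub>E UNIV" "ell z' = ell z" "rho z' = rho z"
      "q < sum z A \<longrightarrow> (\<exists>i\<in>{1..k}. 0 < z i \<and> 0 < z' i)"
      "b \<le> int (z' k)" "i \<in> A" "s i \<le> b * p" using exchange[OF p] by metis
  have "0 < b * p" using z'(6,7) unfolding A_def by simp
  then have "0 < b" using p by (simp add: zero_less_mult_iff)
  then have "0 < z' k" using z'(5) by linarith
  moreover have "\<exists>i\<in>{1..k}. 0 < z i \<and> 0 < z' i" if "int q * S < comb s z"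
  proof -
    have "int q < int (sum z A)" unfolding A_def
      by (rule many_of_large_comb[of s, OF s_nonneg s_le that])
    then have "q < sum z A" by linarith
    then show ?thesis using z'(4) by blast
  qed
  ultimately show thesis using that z' by blast
qed

lemma move_to_first:
  assumes p: "0 < p" and large: "(int q - 1) * T < comb t z"
  obtains z' where "z' \<in> {1..k} \<rightarrow>\<^sub>E UNIV" "ell z' = ell z" "rho z' = rho z" "0 < z' 1"
    "int q * T < comb t z \<longrightarrow> (\<exists>i\<in>{1..k}. 0 < z i \<and> 0 < z' i)"
proof -
  define A where "A = {i \<in> {1..k}. 0 < t i}"
  have "int q - 1 < int (sum z A)" unfolding A_def
    by (rule many_of_large_comb[of t, OF t_nonneg t_le large])
  then have "q \<le> sum z A" by linarith
  moreover have "A \<subseteq> {1..k}" by (auto simp: A_def)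
  ultimately obtain z' a b i where
    z': "z' \<in> {1..k} \<rightarrow>\<^sub>E UNIV" "ell z' = ell z" "rho z' = rho z"
      "q < sum z A \<longrightarrow> (\<exists>i\<in>{1..k}. 0 < z i \<and> 0 < z' i)"
      "a \<le> int (z' 1)" "i \<in> A" "t i \<le> a * p" using exchange[OF p] by metis
  have "0 < a * p" using z'(6,7) unfolding A_def by simp
  then have "0 < a" using p by (simp add: zero_less_mult_iff)
  then have "0 < z' 1" using z'(5) by linarith
  moreover have "\<exists>i\<in>{1..k}. 0 < z i \<and> 0 < z' i" if "int q * T < comb t z"
  proof -
    have "int q < int (sum z A)" unfolding A_def
      by (rule many_of_large_comb[of t, OF t_nonneg t_le that])
    then have "q < sum z A" by linarith
    then show ?thesis using z'(4) by blast
  qed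
  ultimately show thesis using that z' by blast
qed

section \<open>The bidegree monoid and its saturation\<close>

definition fiber :: "int \<Rightarrow> int \<Rightarrow> (nat \<Rightarrow> nat) set" where
  "fiber x y = {z \<in> {1..k} \<rightarrow>\<^sub>E UNIV. ell z = x \<and> rho z = y}"

definition in_monoid :: "int \<Rightarrow> int \<Rightarrow> bool" where
  "in_monoid x y \<longleftrightarrow> fiber x y \<noteq> {}"

lemma in_monoidI: "in_monoid (ell z) (rho z)"
proof -
  have "restrict z {1..k} \<in> fiber (ell z) (rho z)" by (simp add: fiber_def comb_restrict)
  then show ?thesis by (auto simp: in_monoid_def)
qed

lemma in_monoidE: assumes "in_monoid x y" obtains z where "z \<in> fiber x y"
  using assms by (auto simp: in_monoid_def)

lemma fiberD: "z \<in> fiber x y \<Longrightarrow> ell z = x" "z \<in> fiber x y \<Longrightarrow> rho z = y"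
  "z \<in> fiber x y \<Longrightarrow> z \<in> {1..k} \<rightarrow>\<^sub>E UNIV"
  by (auto simp: fiber_def)

lemma in_monoid_nonneg:
  assumes "in_monoid x y"
  shows "0 \<le> x" "0 \<le> y" "0 \<le> det1 x y" "0 \<le> detk x y"
proof -
  obtain z where z: "ell z = x" "rho z = y" using assms fiberD in_monoidE by metis
  show "0 \<le> x" "0 \<le> y" using z comb_nonneg[of "\<lambda>i. int (w i)" z] comb_nonneg[of "\<lambda>i. int (r i)" z]
    by auto
  show "0 \<le> det1 x y" "0 \<le> detk x y"
    using comb_nonneg[of s z] comb_nonneg[of t z] s_nonneg t_nonneg by (auto simp: comb_s comb_t z)
qed

lemma in_monoid_add_gen:
  assumes "in_monoid x y" "i \<in> {1..k}"
  shows "in_monoid (x + int c * int (w i)) (y + int c * int (r i))"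
proof -
  obtain z where z: "ell z = x" "rho z = y" using assms fiberD in_monoidE by metis
  show ?thesis
    using in_monoidI[of "\<lambda>l. z l + (if l = i then c else 0)"] assms(2)
    by (simp add: comb_add comb_unit z mult.commute)
qed

text \<open>
  Removability of a generator from a point of the monoid means that it occurs in some factorization;
  in this form the supports of factorizations can be compared without mentioning factorizations.
\<close>
lemma in_monoid_minus_gen_iff:
  assumes "i \<in> {1..k}"
  shows "in_monoid (x - int (w i)) (y - int (r i)) \<longleftrightarrow> (\<exists>z\<in>fiber x y. 0 < z i)"
proof
  assume "in_monoid (x - int (w i)) (y - int (r i))"
  then obtain z where z: "ell z = x - int (w i)" "rho z = y - int (r i)" using fiberD in_monoidE by metis
  define z' where "z' = restrict (\<lambda>l. z l + (if l = i then 1 else 0)) {1..k}"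
  have "z' \<in> fiber x y" unfolding fiber_def using assms
    by (auto simp: z'_def comb_restrict comb_add comb_unit z)
  moreover have "0 < z' i" using assms by (simp add: z'_def)
  ultimately show "\<exists>z\<in>fiber x y. 0 < z i" by blast
next
  assume "\<exists>z\<in>fiber x y. 0 < z i"
  then obtain z where z: "z \<in> fiber x y" "0 < z i" by blast
  have "comb f (\<lambda>l. z l - (if l = i then 1 else 0)) = comb f z - f i" for f
    using z(2) assms by (subst comb_diff) (auto simp: comb_unit)
  then show "in_monoid (x - int (w i)) (y - int (r i))"
    using in_monoidI[of "\<lambda>l. z l - (if l = i then 1 else 0)"] fiberD[OF z(1)] by simp
qed

lemma in_monoid_minus_last:
  assumes "0 < p" "in_monoid x y" "(int q - 1) * S < det1 x y"
  shows "in_monoid (x - int (w k)) (y - int (r k))"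
proof -
  obtain z where z: "z \<in> fiber x y" using assms in_monoidE by metis
  have "(int q - 1) * S < comb s z" using assms(3) by (simp add: comb_s fiberD[OF z])
  from move_to_last[OF assms(1) this] obtain z' where
    "z' \<in> {1..k} \<rightarrow>\<^sub>E UNIV" "ell z' = ell z" "rho z' = rho z" "0 < z' k" .
  then show ?thesis
    using fiberD[OF z] by (auto simp: in_monoid_minus_gen_iff[OF k_in] fiber_def)
qed

lemma in_monoid_minus_first:
  assumes "0 < p" "in_monoid x y" "(int q - 1) * T < detk x y"
  shows "in_monoid (x - int (w 1)) (y - int (r 1))"
proof -
  obtain z where z: "z \<in> fiber x y" using assms in_monoidE by metis
  have "(int q - 1) * T < comb t z" using assms(3) by (simp add: comb_t fiberD[OF z])
  from move_to_first[OF assms(1) this] obtain z' where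
    "z' \<in> {1..k} \<rightarrow>\<^sub>E UNIV" "ell z' = ell z" "rho z' = rho z" "0 < z' 1" .
  then show ?thesis
    using fiberD[OF z] by (auto simp: in_monoid_minus_gen_iff[OF one_in] fiber_def)
qed

text \<open>
  Far from the ray of \<open>v 1\<close>, membership is insensitive to translation along \<open>v k\<close>: every point on
  the way down has a factorization using the generator \<open>k\<close>, which can be removed.
\<close>
lemma in_monoid_cancel_last:
  assumes "0 < p" "in_monoid (x + int c * int (w k)) (y + int c * int (r k))" "(int q - 1) * S \<le> det1 x y"
  shows "in_monoid x y"
  using assms(2)
proof (induction c)
  case (Suc c)
  have "det1 (x + int (Suc c) * int (w k)) (y + int (Suc c) * int (r k))
        = det1 x y + int (Suc c) * p"
    by (simp add: det1_def p_eq algebra_simps)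
  moreover have "0 < int (Suc c) * p" using assms(1) by simp
  ultimately have "(int q - 1) * S < det1 (x + int (Suc c) * int (w k)) (y + int (Suc c) * int (r k))"
    using assms(3) by linarith
  from in_monoid_minus_last[OF assms(1) Suc.prems this] show ?case
    by (intro Suc.IH) (simp add: algebra_simps)
qed simp

lemma in_monoid_cancel_first:
  assumes "0 < p" "in_monoid (x + int c * int (w 1)) (y + int c * int (r 1))" "(int q - 1) * T \<le> detk x y"
  shows "in_monoid x y"
  using assms(2)
proof (induction c)
  case (Suc c)
  have "detk (x + int (Suc c) * int (w 1)) (y + int (Suc c) * int (r 1))
        = detk x y + int (Suc c) * p"
    by (simp add: detk_def p_eq algebra_simps)
  moreover have "0 < int (Suc c) * p" using assms(1) by simp
  ultimately have "(int q - 1) * T < detk (x + int (Suc c) * int (w 1)) (y + int (Suc c) * int (r 1))"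
    using assms(3) by linarith
  from in_monoid_minus_first[OF assms(1) Suc.prems this] show ?case
    by (intro Suc.IH) (simp add: algebra_simps)
qed simp

definition in_group :: "int \<Rightarrow> int \<Rightarrow> bool" where
  "in_group x y \<longleftrightarrow> (\<exists>x1 y1 x2 y2. in_monoid x1 y1 \<and> in_monoid x2 y2 \<and> x = x1 - x2 \<and> y = y1 - y2)"

lemma in_monoid_add: "in_monoid x y \<Longrightarrow> in_monoid x' y' \<Longrightarrow> in_monoid (x + x') (y + y')"
proof -
  assume "in_monoid x y" "in_monoid x' y'"
  then obtain z z' where "z \<in> fiber x y" "z' \<in> fiber x' y'" by (metis in_monoidE)
  then show ?thesis using in_monoidI[of "\<lambda>i. z i + z' i"] by (simp add: comb_add fiberD)
qed

lemma in_group_diff: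
  assumes "in_group x y" "in_group x' y'"
  shows "in_group (x - x') (y - y')"
proof -
  obtain x1 y1 x2 y2 where 1: "in_monoid x1 y1" "in_monoid x2 y2" "x = x1 - x2" "y = y1 - y2"
    using assms(1) by (auto simp: in_group_def)
  obtain x3 y3 x4 y4 where 2: "in_monoid x3 y3" "in_monoid x4 y4" "x' = x3 - x4" "y' = y3 - y4"
    using assms(2) by (auto simp: in_group_def)
  show ?thesis unfolding in_group_def
    by (rule exI[of _ "x1 + x4"], rule exI[of _ "y1 + y4"], rule exI[of _ "x2 + x3"],
        rule exI[of _ "y2 + y3"]) (simp add: 1 2 in_monoid_add)
qed

lemma in_monoid_0: "in_monoid 0 0"
  using in_monoidI[of "\<lambda>_. 0"] by (simp add: comb_def)

lemma in_group_of_in_monoid: "in_monoid x y \<Longrightarrow> in_group x y"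
  unfolding in_group_def using in_monoid_0 by (metis diff_zero)

lemma in_group_mult:
  assumes "in_group x y"
  shows "in_group (c * x) (c * y)"
proof -
  have neg: "in_group (- x) (- y)" if "in_group x y" for x y using in_group_diff[OF in_group_of_in_monoid[OF in_monoid_0] that] by simp
  have nat: "in_group (int m * x) (int m * y)" for m
  proof (induction m)
    case (Suc m)
    show ?case using in_group_diff[OF Suc neg[OF assms]] by (simp add: algebra_simps)
  qed (simp add: in_group_of_in_monoid in_monoid_0)
  show ?thesis
  proof (cases "0 \<le> c")
    case True then show ?thesis using nat[of "nat c"] by simp
  next
    case False then show ?thesis using neg[OF nat[of "nat (-c)"]] by simp
  qed
qed

lemma in_group_gen: "i \<in> {1..k} \<Longrightarrow> in_group (int (w i)) (int (r i))"
  using in_monoid_add_gen[OF in_monoid_0, of i 1] by (intro in_group_of_in_monoid) simp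

text \<open>
  Let \<open>h\<^sub>1 - h\<^sub>2\<close> be a point of the group. Adding \<open>p * h\<^sub>2\<close> puts it into the monoid, and \<open>p * h\<^sub>2\<close> is
  a nonnegative combination of \<open>v 1\<close> and \<open>v k\<close> by Cramer's rule. Far from both rays these copies of
  \<open>v 1\<close> and \<open>v k\<close> can be cancelled again.
\<close>
lemma in_monoid_of_deep_in_group:
  assumes p: "0 < p" and g: "in_group x y" and s: "(int q - 1) * S \<le> det1 x y" and t: "(int q - 1) * T \<le> detk x y"
  shows "in_monoid x y"
proof -
  obtain x1 y1 x2 y2 where 1: "in_monoid x1 y1" "in_monoid x2 y2" "x = x1 - x2" "y = y1 - y2"
    using g by (auto simp: in_group_def)
  define a where "a = nat (detk x2 y2)"
  define b where "b = nat (det1 x2 y2)"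
  have ab: "int a = detk x2 y2" "int b = det1 x2 y2"
    using in_monoid_nonneg[OF 1(2)] by (simp_all add: a_def b_def)
  have mult: "in_monoid (int m * x2) (int m * y2)" for m
  proof (induction m)
    case (Suc m) then show ?case using in_monoid_add[OF Suc 1(2)] by (simp add: algebra_simps)
  qed (simp add: in_monoid_0)
  have "in_monoid (x1 + int (period k w r - 1) * x2) (y1 + int (period k w r - 1) * y2)"
    by (intro in_monoid_add 1 mult)
  also have "x1 + int (period k w r - 1) * x2 = x + int b * int (w k) + int a * int (w 1)"
    using cramer(1)[of x2 y2] p 1 ab by (simp add: algebra_simps of_nat_diff)
  also have "y1 + int (period k w r - 1) * y2 = y + int b * int (r k) + int a * int (r 1)"
    using cramer(2)[of y2 x2] p 1 ab by (simp add: algebra_simps of_nat_diff)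
  finally have "in_monoid (x + int b * int (w k) + int a * int (w 1)) (y + int b * int (r k) + int a * int (r 1))" .
  then have "in_monoid (x + int b * int (w k)) (y + int b * int (r k))"
  proof (rule in_monoid_cancel_first[OF p])
    have "detk (x + int b * int (w k)) (y + int b * int (r k)) = detk x y"
      by (simp add: detk_def algebra_simps)
    then show "(int q - 1) * T \<le> detk (x + int b * int (w k)) (y + int b * int (r k))" using t by simp
  qed
  then show ?thesis using s by (rule in_monoid_cancel_last[OF p])
qed

section \<open>Connectedness of factorization graphs\<close>

definition links :: "(nat \<Rightarrow> nat) set \<Rightarrow> ((nat \<Rightarrow> nat) \<times> (nat \<Rightarrow> nat)) set" where
  "links X = {(z, z'). z \<in> X \<and> z' \<in> X \<and> (\<exists>i\<in>{1..k}. 0 < z i \<and> 0 < z' i)}"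

definition disconnected :: "(nat \<Rightarrow> nat) set \<Rightarrow> bool" where
  "disconnected X \<longleftrightarrow> (\<exists>z\<in>X. \<exists>z'\<in>X. (z, z') \<notin> (links X)\<^sup>*)"

text \<open>
  A union of full bidegree fibers. The set of factorizations of an element of \<open>P\<^sub>n\<close> is one, and so is
  a single fiber; trading generators stays inside such a set.
\<close>
definition graded :: "(nat \<Rightarrow> nat) set \<Rightarrow> bool" where
  "graded X \<longleftrightarrow> (\<forall>z\<in>X. fiber (ell z) (rho z) \<subseteq> X)"

lemma graded_fiber: "graded (fiber x y)"
  by (auto simp: graded_def fiber_def)

lemma sym_links: "sym ((links X)\<^sup>*)"
  by (rule sym_rtrancl) (auto simp: sym_def links_def)

lemma linksI: "z \<in> X \<Longrightarrow> z' \<in> X \<Longrightarrow> i \<in> {1..k} \<Longrightarrow> 0 < z i \<Longrightarrow> 0 < z' i \<Longrightarrow> (z, z') \<in> links X"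
  by (auto simp: links_def)

text \<open>
  Both factorizations are adjacent to factorizations that use the generator \<open>k\<close>, and these are
  adjacent to each other.
\<close>
lemma linked_via_last:
  assumes "0 < p" "graded X" and z: "z1 \<in> X" "z2 \<in> X"
    and large: "int q * S < comb s z1" "int q * S < comb s z2"
  shows "(z1, z2) \<in> (links X)\<^sup>*"
proof -
  have S: "0 \<le> S" by (simp add: S_def)
  have move: "\<exists>u\<in>X. 0 < u k \<and> (z, u) \<in> links X" if z0: "z \<in> X" "int q * S < comb s z" for z
  proof -
    have "(int q - 1) * S < comb s z" using z0(2) S by (simp add: left_diff_distrib)
    from move_to_last[OF assms(1) this] obtain u where u: "u \<in> {1..k} \<rightarrow>\<^sub>E UNIV" "ell u = ell z"
      "rho u = rho z" "0 < u k" "int q * S < comb s z \<longrightarrow> (\<exists>i\<in>{1..k}. 0 < z i \<and> 0 < u i)" .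
    have "u \<in> X" using u(1-3) z0(1) assms(2) by (auto simp: graded_def fiber_def)
    then show ?thesis using u(4) u(5)[rule_format, OF z0(2)] z0(1) by (auto simp: links_def)
  qed
  obtain u1 where 1: "u1 \<in> X" "0 < u1 k" "(z1, u1) \<in> links X" using move z large by blast
  obtain u2 where 2: "u2 \<in> X" "0 < u2 k" "(z2, u2) \<in> links X" using move z large by blast
  have "(u2, z2) \<in> (links X)\<^sup>*" using 2(3) sym_links by (meson r_into_rtrancl symD)
  moreover have "(u1, u2) \<in> links X" using 1 2 k_in by (auto intro: linksI)
  ultimately show ?thesis using 1(3) by (meson converse_rtrancl_into_rtrancl)
qed

lemma linked_via_first:
  assumes "0 < p" "graded X" and z: "z1 \<in> X" "z2 \<in> X"
    and large: "int q * T < comb t z1" "int q * T < comb t z2"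
  shows "(z1, z2) \<in> (links X)\<^sup>*"
proof -
  have T: "0 \<le> T" by (simp add: T_def)
  have move: "\<exists>u\<in>X. 0 < u 1 \<and> (z, u) \<in> links X" if z0: "z \<in> X" "int q * T < comb t z" for z
  proof -
    have "(int q - 1) * T < comb t z" using z0(2) T by (simp add: left_diff_distrib)
    from move_to_first[OF assms(1) this] obtain u where u: "u \<in> {1..k} \<rightarrow>\<^sub>E UNIV" "ell u = ell z"
      "rho u = rho z" "0 < u 1" "int q * T < comb t z \<longrightarrow> (\<exists>i\<in>{1..k}. 0 < z i \<and> 0 < u i)" .
    have "u \<in> X" using u(1-3) z0(1) assms(2) by (auto simp: graded_def fiber_def)
    then show ?thesis using u(4) u(5)[rule_format, OF z0(2)] z0(1) by (auto simp: links_def)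
  qed
  obtain u1 where 1: "u1 \<in> X" "0 < u1 1" "(z1, u1) \<in> links X" using move z large by blast
  obtain u2 where 2: "u2 \<in> X" "0 < u2 1" "(z2, u2) \<in> links X" using move z large by blast
  have "(u2, z2) \<in> (links X)\<^sup>*" using 2(3) sym_links by (meson r_into_rtrancl symD)
  moreover have "(u1, u2) \<in> links X" using 1 2 one_in by (auto intro: linksI)
  ultimately show ?thesis using 1(3) by (meson converse_rtrancl_into_rtrancl)
qed

lemma connected_of_hub:
  assumes "\<And>z. z \<in> X \<Longrightarrow> (z, c) \<in> (links X)\<^sup>*"
  shows "\<not> disconnected X"
  unfolding disconnected_def using assms sym_links by (meson rtrancl_trans symD)

section \<open>The common difference of lengths\<close>

text \<open>
  The least positive length difference of two points of the group on a line \<open>x * n + y = m\<close>.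
\<close>
definition len_step :: "nat \<Rightarrow> nat" where
  "len_step n = (LEAST d. 0 < d \<and> in_group (int d) (- (int d * int n)))"

text \<open>
  The vector \<open>(0, p) = w 1 * v k - w k * v 1\<close> shears the direction \<open>(1, - n)\<close> into
  \<open>(1, - (n + p))\<close>; it is the reason why \<open>p\<close> is the period.
\<close>
lemma in_group_vertical: "in_group 0 (c * p)"
proof -
  have "in_group (int (w 1) * int (w k) - int (w k) * int (w 1)) (int (w 1) * int (r k) - int (w k) * int (r 1))"
    by (intro in_group_diff in_group_mult in_group_gen one_in k_in)
  then have "in_group 0 p" by (simp add: p_eq mult.commute)
  from in_group_mult[OF this, of c] show ?thesis by simp
qed

lemma len_step_props:
  assumes "0 < p"
  shows "0 < len_step n" "in_group (int (len_step n)) (- (int (len_step n) * int n))"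
proof -
  \<comment> \<open>\<open>p * v 1\<close> can be sheared by multiples of \<open>(0, p)\<close> into the direction \<open>(1, - n)\<close>\<close>
  have "in_group (p * int (w 1) - 0) (p * int (r 1) - (int (r 1) + int (w 1) * int n) * p)"
    by (intro in_group_diff in_group_mult in_group_gen one_in in_group_vertical)
  then have "in_group (int (w 1 * period k w r)) (- (int (w 1 * period k w r) * int n))"
    by (simp add: algebra_simps)
  moreover have "0 < w 1 * period k w r" using w1_pos assms by simp
  ultimately have "\<exists>d. 0 < d \<and> in_group (int d) (- (int d * int n))" by blast
  from LeastI_ex[OF this] show "0 < len_step n" "in_group (int (len_step n)) (- (int (len_step n) * int n))"
    unfolding len_step_def by blast+
qed

text \<open>
  The differences in question form a subgroup of the integers, so all are multiples of the least
  positive one.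
\<close>
lemma len_step_dvd:
  assumes "0 < p" "in_group c (- (c * int n))"
  shows "int (len_step n) dvd c"
proof -
  define e where "e = nat (c mod int (len_step n))"
  have e: "int e = c mod int (len_step n)" "e < len_step n"
    using len_step_props(1)[OF assms(1), of n] by (auto simp: e_def nat_less_iff)
  have eq: "int e = c - (c div int (len_step n)) * int (len_step n)"
    unfolding e by (simp add: minus_div_mult_eq_mod)
  have "in_group (c - (c div int (len_step n)) * int (len_step n))
            (- (c * int n) - (c div int (len_step n)) * - (int (len_step n) * int n))"
    by (intro in_group_diff in_group_mult assms len_step_props)
  also have "- (c * int n) - (c div int (len_step n)) * - (int (len_step n) * int n) = - (int e * int n)"
    unfolding eq by (simp add: algebra_simps)
  finally have "in_group (int e) (- (int e * int n))" unfolding eq[symmetric] .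
  moreover have "\<not> (0 < e \<and> in_group (int e) (- (int e * int n)))"
    using e(2) unfolding len_step_def by (rule not_less_Least)
  ultimately have "c mod int (len_step n) = 0" using e(1) by simp
  then show ?thesis by (rule mod_0_imp_dvd)
qed

lemma len_step_shift: "len_step (n + period k w r) = len_step n"
proof -
  have "in_group x (- (x * int (n + period k w r))) \<longleftrightarrow> in_group x (- (x * int n))" for x
  proof
    assume "in_group x (- (x * int (n + period k w r)))"
    from in_group_diff[OF this in_group_vertical[of "- x"]] show "in_group x (- (x * int n))"
      by (simp add: algebra_simps)
  next
    assume "in_group x (- (x * int n))"
    from in_group_diff[OF this in_group_vertical[of x]] show "in_group x (- (x * int (n + period k w r)))"
      by (simp add: algebra_simps)
  qed
  then show ?thesis by (simp add: len_step_def)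
qed

lemma in_monoid_shift_last:
  assumes "0 < p" "(int q - 1) * S \<le> det1 x y"
  shows "in_monoid (x + int c * int (w k)) (y + int c * int (r k)) \<longleftrightarrow> in_monoid x y"
  using in_monoid_cancel_last[OF assms(1) _ assms(2)] in_monoid_add_gen[OF _ k_in] by blast

lemma in_monoid_shift_first:
  assumes "0 < p" "(int q - 1) * T \<le> detk x y"
  shows "in_monoid (x + int c * int (w 1)) (y + int c * int (r 1)) \<longleftrightarrow> in_monoid x y"
  using in_monoid_cancel_first[OF assms(1) _ assms(2)] in_monoid_add_gen[OF _ one_in] by blast

section \<open>Factorizations in the shifted family\<close>

lemma fact_iff:
  "z \<in> factorizations k (shifted_gens w r n) m \<longleftrightarrow>
     z \<in> {1..k} \<rightarrow>\<^sub>E UNIV \<and> int m = ell z * int n + rho z"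
proof -
  have "int (\<Sum>i=1..k. z i * shifted_gens w r n i) = ell z * int n + rho z"
    by (simp add: comb_def shifted_gens_def sum_distrib_left sum.distrib algebra_simps)
  from this[symmetric] show ?thesis
    by (simp only: factorizations_def mem_Collect_eq of_nat_eq_iff)
qed

lemma graded_fact: "graded (factorizations k (shifted_gens w r n) m)"
  by (auto simp: graded_def fiber_def fact_iff)

lemma betti_iff:
  "m \<in> betti k (shifted_gens w r n) \<longleftrightarrow> disconnected (factorizations k (shifted_gens w r n) m)"
proof -
  have "links (factorizations k g m) = factorization_edges k g m" for g
    by (simp add: links_def factorization_edges_def)
  moreover have "m \<in> monoid_gen k g" if "z \<in> factorizations k g m" for g z
    using that by (auto simp: factorizations_def monoid_gen_def)
  ultimately show ?thesis by (auto simp: betti_def disconnected_def)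
qed

lemma wlength_eq: "int (wlength k w z) = ell z"
  by (simp add: wlength_def comb_def)

lemma wlength_set_image:
  "int ` wlength_set k w (shifted_gens w r n) m = ell ` factorizations k (shifted_gens w r n) m"
  by (simp add: wlength_set_def image_image wlength_eq)

text \<open>
  Period zero means that all generators lie on the ray of \<open>v 1\<close>, on which the value determines the
  length.
\<close>
lemma lengths_of_zero_period:
  assumes "period k w r = 0" "0 < n"
    and z: "z \<in> factorizations k (shifted_gens w r n) m" "z' \<in> factorizations k (shifted_gens w r n) m"
  shows "wlength k w z = wlength k w z'"
proof -
  have "s i = 0" if i: "i \<in> {1..k}" for i
  proof -
    have "t i * int (w 1) + s i * int (w k) = 0"
      using cramer(1)[of "int (w i)" "int (r i)"] assms(1) by simp
    moreover have "0 \<le> t i * int (w 1)" "0 \<le> s i * int (w k)" using t_nonneg[OF i] s_nonneg[OF i] by auto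
    ultimately have "s i * int (w k) = 0" by linarith
    then show ?thesis using wk_pos by simp
  qed
  then have "comb s u = 0" for u by (simp add: comb_def)
  then have rho: "int (w 1) * rho u = int (r 1) * ell u" for u
    unfolding comb_s unfolding det1_def by simp
  have "int (w 1) * int m = ell u * (int (w 1) * int n + int (r 1))"
    if "u \<in> factorizations k (shifted_gens w r n) m" for u
  proof -
    have "int (w 1) * int m = int (w 1) * (ell u * int n) + int (w 1) * rho u"
      using that by (simp add: fact_iff distrib_left)
    then show ?thesis unfolding rho by (simp add: algebra_simps)
  qed
  from this[OF z(1)] this[OF z(2)]
  have "ell z * (int (w 1) * int n + int (r 1)) = ell z' * (int (w 1) * int n + int (r 1))"
    by (rule trans[OF sym])
  moreover have "0 < int (w 1) * int n + int (r 1)" using w1_pos assms(2) by (simp add: add_pos_nonneg)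
  ultimately have "ell z = ell z'" by simp
  then show ?thesis unfolding wlength_eq[symmetric] by simp
qed

end

section \<open>Lengths for large shifts\<close>

locale large_shift = shifted_family +
  fixes n :: nat
  assumes p_pos: "0 < p"
    and n_large: "(w 1)\<^sup>2 * W * R\<^sup>2 < n"
begin

abbreviation d :: nat where "d \<equiv> len_step n"
abbreviation gen :: "nat \<Rightarrow> nat" where "gen \<equiv> shifted_gens w r n"
abbreviation fact :: "nat \<Rightarrow> (nat \<Rightarrow> nat) set" where "fact \<equiv> factorizations k gen"
abbreviation first_gen :: int where "first_gen \<equiv> int (w 1) * int n + int (r 1)"
abbreviation last_gen :: int where "last_gen \<equiv> int (w k) * int n + int (r k)"

lemma d_pos: "0 < d" and d_in_group: "in_group (int d) (- (int d * int n))"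
  using len_step_props[OF p_pos] by auto

text \<open>
  The bound \<open>n > (w 1)\<^sup>2 W R\<^sup>2\<close> enters only here. Both estimates rest on
  \<open>p \<le> w 1 * R\<close>, which gives \<open>q * T \<le> (w 1)\<^sup>2 W R\<^sup>2\<close> and \<open>q * S \<le> (w 1)\<^sup>3 R\<^sup>2\<close>.
\<close>
lemma gens_large: "int q * S < first_gen" "int q * T < last_gen"
proof -
  have pS: "p \<le> S" using s_le[OF k_in] s_k by simp
  have W: "1 \<le> W" using w_le_W[OF one_in] w_ge_1[OF one_in] by linarith
  have n: "int (w 1) ^ 2 * int W * int R ^ 2 < int n"
    using n_large by (metis of_nat_less_iff of_nat_mult of_nat_power)
  have q: "int q = int (w 1) * p" by (simp add: q_def)
  have "int q * S \<le> int (w 1) * S * S"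
    unfolding q using pS by (intro mult_right_mono mult_left_mono) (auto simp: S_def)
  also have "\<dots> = int (w 1) * (int (w 1) ^ 2 * 1 * int R ^ 2)"
    by (simp add: S_def power2_eq_square)
  also have "\<dots> \<le> int (w 1) * (int (w 1) ^ 2 * int W * int R ^ 2)"
    using W by (intro mult_left_mono mult_right_mono) auto
  also have "\<dots> < int (w 1) * int n" using n w1_pos by simp
  finally show "int q * S < first_gen" by simp
  have "int q * T \<le> int (w 1) * S * T"
    unfolding q using pS by (intro mult_right_mono mult_left_mono) (auto simp: T_def)
  also have "\<dots> = int (w 1) ^ 2 * int W * int R ^ 2"
    by (simp add: S_def T_def power2_eq_square)
  also have "\<dots> < 1 * int n" using n by simp
  also have "\<dots> \<le> int (w k) * int n" using wk_pos by (intro mult_right_mono) auto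
  finally show "int q * T < last_gen" by simp
qed

lemma S_T_nonneg: "0 \<le> S" "0 \<le> T"
  by (simp_all add: S_def T_def)

lemma gens_pos: "0 < first_gen" "0 < last_gen"
proof -
  have "0 \<le> int q * S" "0 \<le> int q * T" using S_T_nonneg by auto
  then show "0 < first_gen" "0 < last_gen" using gens_large by linarith+
qed

text \<open>
  Along a line \<open>x * n + y = m\<close>, one step in length changes the distances to the rays by the first
  and by the last generator of \<open>P\<^sub>n\<close>.
\<close>
lemma det_along:
  assumes "x * int n + y = x' * int n + y'"
  shows "det1 x y = det1 x' y' + (x' - x) * first_gen"
    "detk x' y' = detk x y + (x' - x) * last_gen"
proof -
  have y: "y = x' * int n + y' - x * int n" using assms by simp
  show "det1 x y = det1 x' y' + (x' - x) * first_gen"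
    "detk x' y' = detk x y + (x' - x) * last_gen"
    by (simp_all add: y det1_def detk_def algebra_simps)
qed

lemma fact_value: "z \<in> fact m \<Longrightarrow> ell z * int n + rho z = int m"
  by (simp add: fact_iff)

lemma fact_in_monoid: "z \<in> fact m \<Longrightarrow> in_monoid (ell z) (rho z)"
  by (rule in_monoidI)

lemma fiber_subset_fact: "int m = x * int n + y \<Longrightarrow> fiber x y \<subseteq> fact m"
  by (auto simp: fact_iff fiber_def)

lemma shorter_deep:
  assumes "z \<in> fact m" "z' \<in> fact m" "ell z < ell z'"
  shows "first_gen \<le> comb s z" "last_gen \<le> comb t z'"
proof -
  have e: "ell z * int n + rho z = ell z' * int n + rho z'" using assms fact_value by simp
  have "1 * first_gen \<le> (ell z' - ell z) * first_gen"
    using assms(3) gens_pos by (intro mult_right_mono) auto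
  then show "first_gen \<le> comb s z"
    using det_along(1)[OF e] in_monoid_nonneg(3)[OF fact_in_monoid[OF assms(2)]] by (simp add: comb_s)
  have "1 * last_gen \<le> (ell z' - ell z) * last_gen"
    using assms(3) gens_pos by (intro mult_right_mono) auto
  then show "last_gen \<le> comb t z'"
    using det_along(2)[OF e] in_monoid_nonneg(4)[OF fact_in_monoid[OF assms(1)]] by (simp add: comb_t)
qed

lemma linked_shorter:
  assumes "z1 \<in> fact m" "z2 \<in> fact m" "z1' \<in> fact m" "z2' \<in> fact m" "ell z1 < ell z1'" "ell z2 < ell z2'"
  shows "(z1, z2) \<in> (links (fact m))\<^sup>*"
  using shorter_deep(1)[OF assms(1) assms(3) assms(5)] shorter_deep(1)[OF assms(2) assms(4) assms(6)]
    gens_large(1)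
  by (intro linked_via_last[OF p_pos graded_fact assms(1,2)]) linarith+

lemma linked_longer:
  assumes "z1 \<in> fact m" "z2 \<in> fact m" "z1' \<in> fact m" "z2' \<in> fact m" "ell z1' < ell z1" "ell z2' < ell z2"
  shows "(z1, z2) \<in> (links (fact m))\<^sup>*"
  using shorter_deep(2)[OF assms(3) assms(1) assms(5)] shorter_deep(2)[OF assms(4) assms(2) assms(6)]
    gens_large(2)
  by (intro linked_via_first[OF p_pos graded_fact assms(1,2)]) linarith+

lemma length_diff_dvd:
  assumes "z \<in> fact m" "z' \<in> fact m"
  shows "int d dvd ell z' - ell z"
proof (rule len_step_dvd[OF p_pos])
  have "in_group (ell z' - ell z) (rho z' - rho z)"
    by (intro in_group_diff in_group_of_in_monoid in_monoidI)
  also have "rho z' - rho z = - ((ell z' - ell z) * int n)"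
    using fact_value[OF assms(1)] fact_value[OF assms(2)] by (simp add: algebra_simps)
  finally show "in_group (ell z' - ell z) (- ((ell z' - ell z) * int n))" .
qed

lemma length_diff_ge:
  assumes "z \<in> fact m" "z' \<in> fact m" "ell z < ell z'"
  shows "ell z + int d \<le> ell z'"
  using zdvd_imp_le[OF length_diff_dvd[OF assms(1,2)]] assms(3) by simp

text \<open>
  If the two lengths differ by more than \<open>d\<close>, the point at length \<open>ell z + d\<close> lies strictly between
  two points of the monoid on the line, hence far from both rays, and saturation applies.
\<close>
lemma gap_filled:
  assumes z: "z \<in> fact m" "z' \<in> fact m" and lt: "ell z < ell z'"
  shows "\<exists>u\<in>fact m. ell u = ell z + int d"
proof (cases "ell z' = ell z + int d")
  case True
  then show ?thesis using z by (intro bexI[of _ z'])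
next
  case False
  then have far: "ell z + int d < ell z'" using length_diff_ge[OF z lt] by linarith
  define x where "x = ell z + int d"
  define y where "y = rho z - int d * int n"
  have line: "x * int n + y = int m"
    using fact_value[OF z(1)] by (simp add: x_def y_def algebra_simps)
  have g: "in_group x y"
    using in_group_diff[OF in_group_of_in_monoid[OF in_monoidI[of z]] in_group_diff[OF in_group_of_in_monoid[OF in_monoid_0] d_in_group]]
    by (simp add: x_def y_def)
  have "1 * first_gen \<le> (ell z' - x) * first_gen"
    using far gens_pos by (intro mult_right_mono) (auto simp: x_def)
  then have "first_gen \<le> det1 x y"
    using det_along(1)[of x y "ell z'" "rho z'"] line fact_value[OF z(2)]
      in_monoid_nonneg(3)[OF fact_in_monoid[OF z(2)]] by simp
  then have s: "(int q - 1) * S \<le> det1 x y"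
    using gens_large S_T_nonneg by (simp add: left_diff_distrib)
  have "1 * last_gen \<le> (x - ell z) * last_gen"
    using d_pos gens_pos by (intro mult_right_mono) (auto simp: x_def)
  then have "last_gen \<le> detk x y"
    using det_along(2)[of "ell z" "rho z" x y] line fact_value[OF z(1)]
      in_monoid_nonneg(4)[OF fact_in_monoid[OF z(1)]] by simp
  then have t: "(int q - 1) * T \<le> detk x y"
    using gens_large S_T_nonneg by (simp add: left_diff_distrib)
  obtain u where u: "u \<in> fiber x y" using in_monoid_of_deep_in_group[OF p_pos g s t] in_monoidE by blast
  moreover have "ell u = ell z + int d" using fiberD(1)[OF u] by (simp add: x_def)
  ultimately show ?thesis using fiber_subset_fact[OF line[symmetric]] by blast
qed

lemma delta_subset: "delta_set k w gen \<subseteq> {d}"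
proof
  fix e assume "e \<in> delta_set k w gen"
  then obtain m a b where ab: "a \<in> wlength_set k w gen m" "b \<in> wlength_set k w gen m" "a < b"
      "{a<..<b} \<inter> wlength_set k w gen m = {}" "e = b - a"
    by (auto simp: delta_set_def gaps_def)
  obtain z z' where z: "z \<in> fact m" "z' \<in> fact m" "a = wlength k w z" "b = wlength k w z'"
    using ab by (auto simp: wlength_set_def)
  have lt: "ell z < ell z'" using z ab(3) by (simp add: wlength_eq[symmetric])
  obtain u where u: "u \<in> fact m" "ell u = ell z + int d" using gap_filled[OF z(1,2) lt] by blast
  have "int (wlength k w u) = int (a + d)" using u(2) z(3) by (simp add: wlength_eq)
  then have "wlength k w u = a + d" by (simp only: of_nat_eq_iff)
  then have "a + d \<in> wlength_set k w gen m"
    using imageI[OF u(1), of "wlength k w"] by (simp add: wlength_set_def)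
  then have "a + d \<notin> {a<..<b}" using ab(4) by blast
  moreover have "int a + int d \<le> int b"
    using length_diff_ge[OF z(1,2) lt] z by (simp add: wlength_eq)
  ultimately have "b = a + d" using d_pos by auto
  then show "e \<in> {d}" using ab(5) by simp
qed

section \<open>The two kinds of Betti elements\<close>

text \<open>
  A second point on the line would be shorter or longer, and would thereby force the fiber of
  \<open>(x, y)\<close> away from one of the rays, where all its factorizations are linked to each other.
\<close>
lemma fact_eq_disconnected_fiber:
  assumes "disconnected (fiber x y)" and m: "int m = x * int n + y"
  shows "fact m = fiber x y"
proof (rule ccontr)
  assume "fact m \<noteq> fiber x y"
  then obtain v where v: "v \<in> fact m" "v \<notin> fiber x y" using fiber_subset_fact[OF m] by blast
  have "ell v \<noteq> x"
  proof
    assume "ell v = x"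
    then have "rho v = y" using fact_value[OF v(1)] m by simp
    then show False using v \<open>ell v = x\<close> by (simp add: fiber_def fact_iff)
  qed
  then consider "ell v < x" | "x < ell v" by linarith
  then have "(z, z') \<in> (links (fiber x y))\<^sup>*" if "z \<in> fiber x y" "z' \<in> fiber x y" for z z'
  proof cases
    case 1
    then show ?thesis
      using that shorter_deep(2)[OF v(1), of z] shorter_deep(2)[OF v(1), of z'] gens_large(2)
        fiber_subset_fact[OF m]
      by (intro linked_via_first p_pos graded_fiber) (auto simp: fiberD(1))
  next
    case 2
    then show ?thesis
      using that shorter_deep(1)[OF _ v(1), of z] shorter_deep(1)[OF _ v(1), of z'] gens_large(1)
        fiber_subset_fact[OF m]
      by (intro linked_via_last p_pos graded_fiber) (auto simp: fiberD(1))
  qed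
  then show False using assms(1) by (auto simp: disconnected_def)
qed

text \<open>
  Shorter points of the neighbouring pairs of points on a line that share no removable generator,
  that is, for which no factorization of one is adjacent to a factorization of the other.
\<close>
definition pairs :: "(int \<times> int) set" where
  "pairs = {(x, y). in_monoid x y \<and> in_monoid (x + int d) (y - int d * int n) \<and>
     \<not> (\<exists>i\<in>{1..k}. in_monoid (x - int (w i)) (y - int (r i)) \<and>
          in_monoid (x + int d - int (w i)) (y - int d * int n - int (r i)))}"

lemma betti_single:
  assumes "disconnected (fiber x y)" and m: "int m = x * int n + y"
  shows "m \<in> betti k gen" "ell ` fact m = {x}"
proof -
  have f: "fact m = fiber x y" by (rule fact_eq_disconnected_fiber[OF assms])
  then show "m \<in> betti k gen" using assms(1) by (simp add: betti_iff)
  have "fiber x y \<noteq> {}" using assms(1) by (auto simp: disconnected_def)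
  then show "ell ` fact m = {x}" unfolding f using fiberD(1) by auto
qed

lemma pairs_deep:
  assumes "in_monoid x y" "in_monoid (x + int d) (y - int d * int n)"
  shows "int d * first_gen \<le> det1 x y" "int d * last_gen \<le> detk (x + int d) (y - int d * int n)"
proof -
  have e: "x * int n + y = (x + int d) * int n + (y - int d * int n)" by (simp add: algebra_simps)
  show "int d * first_gen \<le> det1 x y" "int d * last_gen \<le> detk (x + int d) (y - int d * int n)"
    using det_along[OF e] in_monoid_nonneg(4)[OF assms(1)] in_monoid_nonneg(3)[OF assms(2)] by auto
qed

lemma gen_le_d_mult: "first_gen \<le> int d * first_gen" "last_gen \<le> int d * last_gen"
  using d_pos gens_pos by (simp_all add: mult_le_cancel_right1)

text \<open>
  A third point on the line cannot exist: beyond the shorter point it would make the generator \<open>1\<close>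
  removable from both points of the pair, beyond the longer one the generator \<open>k\<close>. So the
  factorizations form two nonempty classes without an edge between them.
\<close>
lemma betti_pair:
  assumes "(x, y) \<in> pairs" and m: "int m = x * int n + y"
  shows "m \<in> betti k gen" "ell ` fact m = {x, x + int d}"
proof -
  define y' where "y' = y - int d * int n"
  have in_monoid: "in_monoid x y" "in_monoid (x + int d) y'"
    and no: "\<And>i. i \<in> {1..k} \<Longrightarrow> in_monoid (x - int (w i)) (y - int (r i)) \<Longrightarrow>
               in_monoid (x + int d - int (w i)) (y' - int (r i)) \<Longrightarrow> False"
    using assms(1) unfolding pairs_def y'_def mem_Collect_eq split_conv by blast+
  have m': "int m = (x + int d) * int n + y'" using m by (simp add: y'_def algebra_simps)
  obtain z where z: "z \<in> fiber x y" using in_monoid in_monoidE by blast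
  obtain z' where z': "z' \<in> fiber (x + int d) y'" using in_monoid in_monoidE by blast
  have zf: "z \<in> fact m" "z' \<in> fact m" using z z' fiber_subset_fact[OF m] fiber_subset_fact[OF m'] by auto
  have ez: "ell z = x" "ell z' = x + int d" by (rule fiberD(1)[OF z], rule fiberD(1)[OF z'])
  have st: "int q * S < comb s z" "int q * T < comb t z'"
    using shorter_deep[OF zf] gens_large d_pos by (auto simp: ez)
  have S: "(int q - 1) * S < det1 x y" "(int q - 1) * T < detk (x + int d) y'"
    using st S_T_nonneg fiberD[OF z] fiberD[OF z'] by (auto simp: comb_s comb_t left_diff_distrib)
  have lengths: "ell u = x \<or> ell u = x + int d" if u: "u \<in> fact m" for u
  proof (rule ccontr)
    assume "\<not> ?thesis"
    moreover have "\<not> (x < ell u \<and> ell u < x + int d)"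
      using length_diff_ge[OF zf(1) u] ez by auto
    ultimately consider "ell u < x" | "x + int d < ell u" by linarith
    then show False
    proof cases
      case 1
      then have "int q * T < comb t z"
        using shorter_deep(2)[OF u zf(1)] gens_large ez by auto
      then have "(int q - 1) * T < detk x y"
        using S_T_nonneg fiberD[OF z] by (auto simp: comb_t left_diff_distrib)
      then show False
        using no[OF one_in in_monoid_minus_first[OF p_pos in_monoid(1)] in_monoid_minus_first[OF p_pos in_monoid(2) S(2)]]
        by blast
    next
      case 2
      then have "int q * S < comb s z'"
        using shorter_deep(1)[OF zf(2) u] gens_large ez by auto
      then have "(int q - 1) * S < det1 (x + int d) y'"
        using S_T_nonneg fiberD[OF z'] by (auto simp: comb_s left_diff_distrib)
      then show False
        using no[OF k_in in_monoid_minus_last[OF p_pos in_monoid(1) S(1)] in_monoid_minus_last[OF p_pos in_monoid(2)]]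
        by blast
    qed
  qed
  show "ell ` fact m = {x, x + int d}"
  proof
    show "ell ` fact m \<subseteq> {x, x + int d}" using lengths by blast
    show "{x, x + int d} \<subseteq> ell ` fact m"
      using imageI[OF zf(1), of ell] imageI[OF zf(2), of ell] by (simp add: ez)
  qed
  have in_fiber: "u \<in> fiber x y" if "u \<in> fact m" "ell u = x" for u
    using that m by (auto simp: fiber_def fact_iff)
  have in_fiber': "u \<in> fiber (x + int d) y'" if "u \<in> fact m" "ell u = x + int d" for u
    using that m' by (auto simp: fiber_def fact_iff)
  \<comment> \<open>a path starting at the shorter point never leaves it\<close>
  have "ell u = x" if "(z, u) \<in> (links (fact m))\<^sup>*" for u
    using that
  proof (induction rule: rtrancl_induct)
    case base
    then show ?case by (rule ez)
  next
    case (step u v)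
    then obtain i where i: "u \<in> fact m" "v \<in> fact m" "i \<in> {1..k}" "0 < u i" "0 < v i"
      by (auto simp: links_def)
    show ?case
    proof (rule ccontr)
      assume "ell v \<noteq> x"
      then have "v \<in> fiber (x + int d) y'" using lengths in_fiber' i by blast
      moreover have "u \<in> fiber x y" using in_fiber i step by blast
      ultimately have "in_monoid (x - int (w i)) (y - int (r i))"
        "in_monoid (x + int d - int (w i)) (y' - int (r i))"
        using i(4,5) unfolding in_monoid_minus_gen_iff[OF i(3)] by blast+
      then show False by (rule no[OF i(3)])
    qed
  qed
  then have "(z, z') \<in> (links (fact m))\<^sup>* \<Longrightarrow> ell z' = x" by blast
  then have "(z, z') \<notin> (links (fact m))\<^sup>*" using ez(2) d_pos by auto
  then show "m \<in> betti k gen" unfolding betti_iff disconnected_def using zf by blast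
qed

text \<open>
  If there are several lengths, consider the least one and the next, which is larger by \<open>d\<close>. Were
  there a generator removable from both points, it would provide an edge between them; as all
  factorizations of least length are linked to each other, and so are all the longer ones, the whole
  graph would be connected.
\<close>
lemma betti_cases:
  assumes "m \<in> betti k gen"
  obtains (single) x y where "disconnected (fiber x y)" "int m = x * int n + y"
  | (pair) x y where "(x, y) \<in> pairs" "int m = x * int n + y"
proof -
  have dis: "disconnected (fact m)" using assms by (simp add: betti_iff)
  then obtain v where v: "v \<in> fact m" by (auto simp: disconnected_def)
  define l where "l = (LEAST j. \<exists>u\<in>fact m. wlength k w u = j)"
  have ex: "\<exists>j. \<exists>u\<in>fact m. wlength k w u = j" using v by blast
  obtain z where z: "z \<in> fact m" "wlength k w z = l" using LeastI_ex[OF ex] by (auto simp: l_def)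
  have least: "ell z \<le> ell u" if "u \<in> fact m" for u
  proof -
    have "l \<le> wlength k w u" unfolding l_def using that by (intro Least_le) blast
    then show ?thesis using z(2) by (simp add: wlength_eq[symmetric])
  qed
  have mz: "int m = ell z * int n + rho z" using fact_value[OF z(1)] by simp
  show thesis
  proof (cases "\<forall>u\<in>fact m. ell u = ell z")
    case True
    have "fact m \<subseteq> fiber (ell z) (rho z)"
    proof
      fix u assume u: "u \<in> fact m"
      then have "ell u = ell z" using True by blast
      moreover from this have "rho u = rho z" using fact_value[OF u] mz by simp
      ultimately show "u \<in> fiber (ell z) (rho z)" using u by (simp add: fiber_def fact_iff)
    qed
    then have "fact m = fiber (ell z) (rho z)" using fiber_subset_fact[OF mz] by blast
    then show thesis using single[of "ell z" "rho z"] dis mz by simp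
  next
    case False
    then obtain v where v: "v \<in> fact m" "ell v \<noteq> ell z" by blast
    have v: "v \<in> fact m" "ell z < ell v" using v least[OF v(1)] by linarith+
    obtain z' where z': "z' \<in> fact m" "ell z' = ell z + int d" using gap_filled[OF z(1) v] by blast
    have rz': "rho z' = rho z - int d * int n"
      using mz fact_value[OF z'(1)] z'(2) by (simp add: algebra_simps)
    have m': "int m = (ell z + int d) * int n + (rho z - int d * int n)"
      using mz by (simp add: algebra_simps)
    have "\<not> (in_monoid (ell z - int (w i)) (rho z - int (r i)) \<and>
             in_monoid (ell z + int d - int (w i)) (rho z - int d * int n - int (r i)))"
      if i: "i \<in> {1..k}" for i
    proof
      assume "in_monoid (ell z - int (w i)) (rho z - int (r i)) \<and>
             in_monoid (ell z + int d - int (w i)) (rho z - int d * int n - int (r i))"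
      then obtain u u' where u: "u \<in> fiber (ell z) (rho z)" "0 < u i"
        "u' \<in> fiber (ell z + int d) (rho z - int d * int n)" "0 < u' i"
        by (auto simp: in_monoid_minus_gen_iff[OF i])
      have uf: "u \<in> fact m" "u' \<in> fact m" using u fiber_subset_fact[OF mz] fiber_subset_fact[OF m'] by auto
      have eu: "ell u = ell z" "ell u' = ell z + int d"
        by (rule fiberD(1)[OF u(1)], rule fiberD(1)[OF u(3)])
      have edge: "(u', u) \<in> links (fact m)" using uf u i by (intro linksI[of _ _ _ i]) auto
      have "(a, u) \<in> (links (fact m))\<^sup>*" if a: "a \<in> fact m" for a
      proof (cases "ell z < ell a")
        case True
        then have "(a, u') \<in> (links (fact m))\<^sup>*"
          using a z uf eu d_pos by (intro linked_longer[of a m u' z z]) auto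
        then show ?thesis using edge by (rule rtrancl_into_rtrancl)
      next
        case False
        then show ?thesis using a uf eu d_pos by (intro linked_shorter[of a m u u' u']) auto
      qed
      then show False using connected_of_hub dis by blast
    qed
    then have "(ell z, rho z) \<in> pairs"
      using in_monoidI[of z] in_monoidI[of z'] by (auto simp: pairs_def z' rz')
    then show thesis using pair mz by blast
  qed
qed

section \<open>Shifting by the period\<close>

text \<open>
  Moving the shorter point along \<open>v k\<close> and the longer point along \<open>v 1\<close> changes neither their
  membership in the monoid nor the set of generators removable from them.
\<close>
lemma removal_shift:
  assumes deep: "first_gen \<le> det1 x y" "last_gen \<le> detk (x + int d) y'"
  shows "in_monoid (x + int c * int (w k)) (y + int c * int (r k)) \<longleftrightarrow> in_monoid x y"
    "i \<in> {1..k} \<Longrightarrow>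
       in_monoid (x + int c * int (w k) - int (w i)) (y + int c * int (r k) - int (r i)) \<longleftrightarrow>
       in_monoid (x - int (w i)) (y - int (r i))"
    "in_monoid (x + int d + int c' * int (w 1)) (y' + int c' * int (r 1)) \<longleftrightarrow> in_monoid (x + int d) y'"
    "i \<in> {1..k} \<Longrightarrow>
       in_monoid (x + int d + int c' * int (w 1) - int (w i)) (y' + int c' * int (r 1) - int (r i)) \<longleftrightarrow>
       in_monoid (x + int d - int (w i)) (y' - int (r i))"
proof -
  have S: "int q * S \<le> det1 x y" and T: "int q * T \<le> detk (x + int d) y'"
    using deep gens_large by auto
  show "in_monoid (x + int c * int (w k)) (y + int c * int (r k)) \<longleftrightarrow> in_monoid x y"
    using S S_T_nonneg by (intro in_monoid_shift_last p_pos) (simp add: left_diff_distrib)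
  show "in_monoid (x + int d + int c' * int (w 1)) (y' + int c' * int (r 1)) \<longleftrightarrow> in_monoid (x + int d) y'"
    using T S_T_nonneg by (intro in_monoid_shift_first p_pos) (simp add: left_diff_distrib)
  show "in_monoid (x + int c * int (w k) - int (w i)) (y + int c * int (r k) - int (r i)) \<longleftrightarrow>
       in_monoid (x - int (w i)) (y - int (r i))" if i: "i \<in> {1..k}"
  proof -
    have "(int q - 1) * S \<le> det1 (x - int (w i)) (y - int (r i))"
      unfolding det_minus using S s_le[OF i] by (simp add: left_diff_distrib)
    from in_monoid_shift_last[OF p_pos this, of c] show ?thesis by (simp add: algebra_simps)
  qed
  show "in_monoid (x + int d + int c' * int (w 1) - int (w i)) (y' + int c' * int (r 1) - int (r i)) \<longleftrightarrow>
       in_monoid (x + int d - int (w i)) (y' - int (r i))" if i: "i \<in> {1..k}"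
  proof -
    have "(int q - 1) * T \<le> detk (x + int d - int (w i)) (y' - int (r i))"
      unfolding det_minus using T t_le[OF i] by (simp add: left_diff_distrib)
    from in_monoid_shift_first[OF p_pos this, of c'] show ?thesis by (simp add: algebra_simps)
  qed
qed

lemma large_shift_next: "large_shift k w r (n + period k w r)"
  by unfold_locales (use p_pos n_large in auto)

text \<open>
  The displacement \<open>d * w 1 * v k\<close> of the shorter point. The longer point of a pair is then
  displaced by \<open>d * w k * v 1\<close>, since \<open>d * (w 1 * v k - w k * v 1) = (0, d * p)\<close> accounts for the
  change of direction of the line.
\<close>
definition shift_pair :: "int \<times> int \<Rightarrow> int \<times> int" where
  "shift_pair = (\<lambda>(x, y). (x + int (d * w 1) * int (w k), y + int (d * w 1) * int (r k)))"

text \<open>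
  For the direction from \<open>n + p\<close> back to \<open>n\<close> it matters that the points for \<open>n + p\<close> are at distance
  at least \<open>d\<close> times a generator of \<open>P\<^sub>n\<^sub>+\<^sub>p\<close> from the rays: the displacement back costs
  \<open>d * w 1 * p\<close> and \<open>d * w k * p\<close>, which leaves \<open>d\<close> times the corresponding generator of \<open>P\<^sub>n\<close>.
\<close>
lemma shift_pair_iff:
  "shift_pair (x, y) \<in> large_shift.pairs k w r (n + period k w r) \<longleftrightarrow> (x, y) \<in> pairs"
proof -
  interpret nxt: large_shift k w r "n + period k w r" by (rule large_shift_next)
  define N where "N = n + period k w r"
  define u v where "u = x + int (d * w 1) * int (w k)" and "v = y + int (d * w 1) * int (r k)"
  define y' where "y' = y - int d * int n"
  have N: "int N = int n + p" by (simp add: N_def)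
  have u': "u + int d = x + int d + int (d * w k) * int (w 1)" by (simp add: u_def mult.commute)
  have v': "v - int d * int N = y' + int (d * w k) * int (r 1)"
    unfolding v_def y'_def N p_eq by (simp add: algebra_simps)
  have pairs: "(x, y) \<in> pairs \<longleftrightarrow> in_monoid x y \<and> in_monoid (x + int d) y' \<and>
     \<not> (\<exists>i\<in>{1..k}. in_monoid (x - int (w i)) (y - int (r i)) \<and>
          in_monoid (x + int d - int (w i)) (y' - int (r i)))"
    by (simp add: pairs_def y'_def)
  have pairs': "(u, v) \<in> nxt.pairs \<longleftrightarrow> in_monoid u v \<and> in_monoid (u + int d) (v - int d * int N) \<and>
     \<not> (\<exists>i\<in>{1..k}. in_monoid (u - int (w i)) (v - int (r i)) \<and>
          in_monoid (u + int d - int (w i)) (v - int d * int N - int (r i)))"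
    unfolding nxt.pairs_def mem_Collect_eq split_conv len_step_shift N_def by (rule refl)
  have iff: "(u, v) \<in> nxt.pairs \<longleftrightarrow> (x, y) \<in> pairs"
    if deep: "first_gen \<le> det1 x y" "last_gen \<le> detk (x + int d) y'"
  proof -
    have "(\<exists>i\<in>{1..k}. in_monoid (u - int (w i)) (v - int (r i)) \<and>
             in_monoid (u + int d - int (w i)) (v - int d * int N - int (r i))) \<longleftrightarrow>
          (\<exists>i\<in>{1..k}. in_monoid (x - int (w i)) (y - int (r i)) \<and>
             in_monoid (x + int d - int (w i)) (y' - int (r i)))"
      unfolding u' v' unfolding u_def v_def
      by (intro bex_cong refl arg_cong2[where f = "(\<and>)"] removal_shift(2,4)[OF deep])
    moreover have "in_monoid u v \<longleftrightarrow> in_monoid x y"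
      unfolding u_def v_def by (rule removal_shift(1)[OF deep])
    moreover have "in_monoid (u + int d) (v - int d * int N) \<longleftrightarrow> in_monoid (x + int d) y'"
      unfolding u' v' by (rule removal_shift(3)[OF deep])
    ultimately show ?thesis unfolding pairs pairs' by simp
  qed
  have "(u, v) \<in> nxt.pairs \<longleftrightarrow> (x, y) \<in> pairs"
  proof
    assume L: "(x, y) \<in> pairs"
    then have "in_monoid x y" "in_monoid (x + int d) (y - int d * int n)" unfolding pairs y'_def by blast+
    from pairs_deep[OF this] have "first_gen \<le> det1 x y" "last_gen \<le> detk (x + int d) y'"
      using gen_le_d_mult unfolding y'_def by linarith+
    from iff[OF this] L show "(u, v) \<in> nxt.pairs" by simp
  next
    assume L: "(u, v) \<in> nxt.pairs"
    then have "in_monoid u v" "in_monoid (u + int d) (v - int d * int N)" unfolding pairs' by blast+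
    from nxt.pairs_deep[of u v, unfolded len_step_shift, folded N_def, OF this]
    have uv: "int d * (int (w 1) * int N + int (r 1)) \<le> det1 u v"
      "int d * (int (w k) * int N + int (r k)) \<le> detk (u + int d) (v - int d * int N)" .
    have "det1 u v = det1 x y + int d * int (w 1) * p"
      by (simp add: u_def v_def det1_def p_eq algebra_simps)
    then have "int d * first_gen \<le> det1 x y" using uv(1) by (simp add: N algebra_simps)
    moreover have "detk (u + int d) (v - int d * int N) = detk (x + int d) y' + int d * int (w k) * p"
      unfolding u' v' by (simp add: detk_def p_eq algebra_simps)
    then have "int d * last_gen \<le> detk (x + int d) y'" using uv(2) by (simp add: N algebra_simps)
    ultimately have "first_gen \<le> det1 x y" "last_gen \<le> detk (x + int d) y'"
      using gen_le_d_mult by linarith+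
    from iff[OF this] L show "(x, y) \<in> pairs" by simp
  qed
  then show ?thesis by (simp add: shift_pair_def u_def v_def)
qed

lemma wlength_set_singleton:
  assumes "ell ` fact m = {x}"
  shows "wlength_set k w gen m = {nat x}"
proof -
  have "wlength_set k w gen m = nat ` int ` wlength_set k w gen m" by (simp add: image_image)
  then show ?thesis unfolding wlength_set_image assms by simp
qed

lemma wlength_set_pair:
  assumes "ell ` fact m = {x, x + int d}"
  shows "wlength_set k w gen m = {nat x, nat x + d}" "0 \<le> x"
proof -
  have "x \<in> int ` wlength_set k w gen m" unfolding wlength_set_image assms by simp
  then show x: "0 \<le> x" by auto
  have "wlength_set k w gen m = nat ` int ` wlength_set k w gen m" by (simp add: image_image)
  also have "\<dots> = {nat x, nat x + d}" unfolding wlength_set_image assms using x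
    by (simp add: nat_add_distrib)
  finally show "wlength_set k w gen m = {nat x, nat x + d}" .
qed

lemma delta_of_pair:
  assumes "wlength_set k w gen m = {l, l + d}"
  shows "delta_set k w gen = {d}"
proof -
  have "l \<in> wlength_set k w gen m" using assms by simp
  then obtain z where "z \<in> fact m" by (auto simp: wlength_set_def)
  then have "m \<in> monoid_gen k gen" by (auto simp: factorizations_def monoid_gen_def)
  moreover have "d \<in> gaps (wlength_set k w gen m)"
    unfolding gaps_def assms mem_Collect_eq
    by (rule exI[of _ l], rule exI[of _ "l + d"]) (use d_pos in auto)
  ultimately have "d \<in> delta_set k w gen" by (auto simp: delta_set_def)
  then show ?thesis using delta_subset by blast
qed

abbreviation bmap :: "nat \<Rightarrow> nat" where "bmap \<equiv> betti_map k w r n"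

lemma bmap_single:
  assumes "disconnected (fiber x y)" and m: "int m = x * int n + y"
  shows "int (bmap m) = x * int (n + period k w r) + y"
proof -
  obtain z where "z \<in> fiber x y" using assms(1) by (auto simp: disconnected_def)
  then have "0 \<le> x" using in_monoid_nonneg(1)[of x y] by (auto simp: in_monoid_def)
  then show ?thesis
    using betti_map_single[OF wlength_set_singleton[OF betti_single(2)[OF assms]]] m
    by (simp add: algebra_simps)
qed

lemma bmap_pair:
  assumes "(x, y) \<in> pairs" and m: "int m = x * int n + y"
  shows "int (bmap m) = fst (shift_pair (x, y)) * int (n + period k w r) + snd (shift_pair (x, y))"
proof -
  note L = wlength_set_pair[OF betti_pair(2)[OF assms]]
  show ?thesis
    using betti_map_pair[OF delta_of_pair[OF L(1)] L(1)] L(2) m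
    by (simp add: shift_pair_def algebra_simps)
qed

lemma delta_and_lengths:
  "delta_set k w gen = {} \<or> (\<exists>e. delta_set k w gen = {e})"
  "m \<in> betti k gen \<Longrightarrow> (\<exists>l. wlength_set k w gen m = {l}) \<or>
     (\<exists>l e. delta_set k w gen = {e} \<and> wlength_set k w gen m = {l, l + e})"
proof -
  show "delta_set k w gen = {} \<or> (\<exists>e. delta_set k w gen = {e})"
    using delta_subset by (auto simp: subset_singleton_iff)
  show "(\<exists>l. wlength_set k w gen m = {l}) \<or>
     (\<exists>l e. delta_set k w gen = {e} \<and> wlength_set k w gen m = {l, l + e})" if "m \<in> betti k gen"
    using that
  proof (cases rule: betti_cases)
    case (single x y)
    then show ?thesis using wlength_set_singleton[OF betti_single(2)] by blast
  next
    case (pair x y)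
    note L = wlength_set_pair(1)[OF betti_pair(2)[OF pair]]
    show ?thesis using L delta_of_pair[OF L] by blast
  qed
qed

text \<open>
  The image determines its preimage: the number of its lengths tells the two kinds apart, its least
  length is the first coordinate of the underlying point for \<open>n + p\<close>, and the value gives the second.
  Surjectivity is the same correspondence of points read backwards.
\<close>
lemma bmap_bij: "bij_betw bmap (betti k gen) (betti k (shifted_gens w r (n + period k w r)))"
proof -
  interpret nxt: large_shift k w r "n + period k w r" by (rule large_shift_next)
  define N where "N = n + period k w r"
  have image_single: "bmap m \<in> betti k nxt.gen \<and> ell ` nxt.fact (bmap m) = {x} \<and>
      y = int (bmap m) - x * int N"
    if "disconnected (fiber x y)" "int m = x * int n + y" for m x y
    using nxt.betti_single[OF that(1) bmap_single[OF that]] bmap_single[OF that]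
    by (simp add: N_def)
  have image_pair: "bmap m \<in> betti k nxt.gen \<and> ell ` nxt.fact (bmap m) = {u, u + int d} \<and>
      v = int (bmap m) - u * int N"
    if xy: "(x, y) \<in> pairs" "int m = x * int n + y" and uv: "(u, v) = shift_pair (x, y)" for m x y u v
  proof -
    have "(u, v) \<in> nxt.pairs" unfolding uv shift_pair_iff by (rule xy(1))
    moreover have "int (bmap m) = u * int N + v"
      using bmap_pair[OF xy] unfolding uv[symmetric] N_def by simp
    ultimately show ?thesis
      using nxt.betti_pair[of u v "bmap m"] unfolding N_def len_step_shift by simp
  qed
  have "inj_on bmap (betti k gen)"
  proof (rule inj_onI)
    fix m1 m2 assume m: "m1 \<in> betti k gen" "m2 \<in> betti k gen" and eq: "bmap m1 = bmap m2"
    show "m1 = m2"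
      using m(1)
    proof (cases rule: betti_cases)
      case 1: (single x1 y1)
      note i1 = image_single[OF 1]
      show ?thesis
        using m(2)
      proof (cases rule: betti_cases)
        case 2: (single x2 y2)
        have "x1 = x2" "y1 = y2" using i1 image_single[OF 2] eq by auto
        then have "int m1 = int m2" using 1 2 by simp
        then show ?thesis by simp
      next
        case 2: (pair x2 y2)
        obtain u v where "(u, v) = shift_pair (x2, y2)" by (metis surj_pair)
        from image_pair[OF 2 this] i1 have "{x1} = {u, u + int d}" by (simp add: eq)
        then show ?thesis using d_pos by auto
      qed
    next
      case 1: (pair x1 y1)
      obtain u1 v1 where uv1: "(u1, v1) = shift_pair (x1, y1)" by (metis surj_pair)
      note i1 = image_pair[OF 1 uv1]
      show ?thesis
        using m(2)
      proof (cases rule: betti_cases)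
        case 2: (single x2 y2)
        from image_single[OF 2] i1 have "{x2} = {u1, u1 + int d}" by (simp add: eq)
        then show ?thesis using d_pos by auto
      next
        case 2: (pair x2 y2)
        obtain u2 v2 where uv2: "(u2, v2) = shift_pair (x2, y2)" by (metis surj_pair)
        note i2 = image_pair[OF 2 uv2]
        have "{u1, u1 + int d} = {u2, u2 + int d}" using i1 i2 eq by simp
        then have "u1 = u2" using d_pos by (auto simp: doubleton_eq_iff)
        then have "v1 = v2" using i1 i2 eq by simp
        with \<open>u1 = u2\<close> uv1 uv2 have "x1 = x2" "y1 = y2" by (auto simp: shift_pair_def)
        then have "int m1 = int m2" using 1 2 by simp
        then show ?thesis by simp
      qed
    qed
  qed
  moreover have "bmap ` betti k gen = betti k nxt.gen"
  proof (intro equalityI subsetI)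
    fix m' assume "m' \<in> bmap ` betti k gen"
    then obtain m where m: "m \<in> betti k gen" "m' = bmap m" by blast
    from m(1) show "m' \<in> betti k nxt.gen"
    proof (cases rule: betti_cases)
      case (single x y)
      then show ?thesis using image_single[OF single] m(2) by simp
    next
      case (pair x y)
      obtain u v where "(u, v) = shift_pair (x, y)" by (metis surj_pair)
      from image_pair[OF pair this] show ?thesis using m(2) by simp
    qed
  next
    fix m' assume "m' \<in> betti k nxt.gen"
    then show "m' \<in> bmap ` betti k gen"
    proof (cases rule: nxt.betti_cases)
      case (single x y)
      have "in_monoid x y" using single(1) by (auto simp: disconnected_def in_monoid_def)
      then have "0 \<le> x * int n + y" using in_monoid_nonneg[of x y] by simp
      then obtain m where m: "int m = x * int n + y" by (metis nonneg_int_cases)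
      have "int (bmap m) = int m'" using bmap_single[OF single(1) m] single(2) by simp
      then have "m' = bmap m" by simp
      then show ?thesis using betti_single(1)[OF single(1) m] by blast
    next
      case (pair u v)
      define x y where "x = u - int (d * w 1) * int (w k)" and "y = v - int (d * w 1) * int (r k)"
      have sh: "shift_pair (x, y) = (u, v)" by (simp add: shift_pair_def x_def y_def)
      then have xy: "(x, y) \<in> pairs" using shift_pair_iff[of x y] pair(1) by simp
      then have "in_monoid x y" by (simp add: pairs_def)
      then have "0 \<le> x * int n + y" using in_monoid_nonneg[of x y] by simp
      then obtain m where m: "int m = x * int n + y" by (metis nonneg_int_cases)
      have "int (bmap m) = int m'" using bmap_pair[OF xy m] pair(2) sh by simp
      then have "m' = bmap m" by simp
      then show ?thesis using betti_pair(1)[OF xy m] by blast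
    qed
  qed
  ultimately show ?thesis by (simp add: bij_betw_def)
qed

end

theorem corollary5p9:
  fixes k n :: nat and w r :: "nat \<Rightarrow> nat"
  assumes "k \<ge> 1"
    and "\<And>i. i \<in> {1..k} \<Longrightarrow> w i \<ge> 1"
    and "mono_on {1..k} (\<lambda>i. real (r i) / real (w i))"
    and "r 1 < w 1"
    and "n > (w 1)\<^sup>2 * Max (w ` {1..k}) * (Max (r ` {1..k}))\<^sup>2"
  shows "(delta_set k w (shifted_gens w r n) = {} \<or>
          (\<exists>d. delta_set k w (shifted_gens w r n) = {d})) \<and>
         (\<forall>\<beta> \<in> betti k (shifted_gens w r n).
            (\<exists>l. wlength_set k w (shifted_gens w r n) \<beta> = {l}) \<or>
            (\<exists>l d. delta_set k w (shifted_gens w r n) = {d} \<and>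
                   wlength_set k w (shifted_gens w r n) \<beta> = {l, l + d})) \<and>
         bij_betw (betti_map k w r n)
           (betti k (shifted_gens w r n))
           (betti k (shifted_gens w r (n + period k w r)))"
proof -
  interpret shifted_family k w r by unfold_locales (use assms in auto)
  let ?g = "shifted_gens w r n"
  show ?thesis
  proof (cases "period k w r = 0")
    case True
    have eq: "a = b" if "a \<in> wlength_set k w ?g m" "b \<in> wlength_set k w ?g m" for a b m
    proof -
      obtain z z' where "z \<in> factorizations k ?g m" "z' \<in> factorizations k ?g m"
        "a = wlength k w z" "b = wlength k w z'"
        using \<open>a \<in> _\<close> \<open>b \<in> _\<close> by (auto simp: wlength_set_def)
      moreover have "0 < n" using assms(5) by linarith
      ultimately show ?thesis using lengths_of_zero_period[OF True] by blast
    qed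
    then have "\<not> a < b" if "a \<in> wlength_set k w ?g m" "b \<in> wlength_set k w ?g m" for a b m
      using that by blast
    then have "gaps (wlength_set k w ?g m) = {}" for m
      unfolding gaps_def by blast
    then have "delta_set k w ?g = {}"
      by (simp add: delta_set_def)
    moreover have single: "\<exists>l. wlength_set k w ?g m = {l}" if m: "m \<in> betti k ?g" for m
    proof -
      obtain z where "z \<in> factorizations k ?g m" using m by (auto simp: betti_def)
      then have "wlength k w z \<in> wlength_set k w ?g m" by (simp add: wlength_set_def)
      then have "wlength_set k w ?g m = {wlength k w z}" using eq by blast
      then show ?thesis ..
    qed
    moreover have "betti_map k w r n m = id m" if m: "m \<in> betti k ?g" for m
    proof -
      obtain l where "wlength_set k w ?g m = {l}" using single[OF m] ..
      then show ?thesis using betti_map_single True by simp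
    qed
    then have "bij_betw (betti_map k w r n) (betti k ?g) (betti k ?g)"
      by (subst bij_betw_cong[where g = id]) simp_all
    ultimately show ?thesis using single True by simp
  next
    case False
    interpret large_shift k w r n
      by unfold_locales (use False assms(5) in \<open>auto simp: W_def R_def\<close>)
    show ?thesis using delta_and_lengths bmap_bij by blast
  qed
qed

end
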